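(* Let $M$ and $N$ be spin factors, and let $\Phi : \mathcal{U}_{min}(M) \to \mathcal{U}_{min}(N)$ be a bijective transformation preserving triple transition pseudo-probabilities, i.e., $TTP(\Phi(v), \Phi(e))=\varphi_{\Phi(e)} (\Phi(v)) = \varphi_{e} (v) = TTP(v,e)$ for all $e,v\in\mathcal{U}_{min} (M)$. Then there exists a unique triple isomorphism $T: M \to N$ whose restriction to $\mathcal{U}_{min} (M)$ is $\Phi$.
   Context: A spin factor is a complex Hilbert space $M$, with $\dim(M)\geq 3$ and inner product $\langle\cdot,\cdot\rangle$ (linear in the first variable), provided with a conjugation $x\mapsto\overline{x}$ (a conjugate-linear isometry of period 2), and equipped with the triple product $$\{x, y, z\} = \langle x, y\rangle z + \langle z, y\rangle x -\langle x, \overline{z}\rangle \overline{y}$$ and the norm given by $\|x\|^2 = \langle x, x\rangle + \sqrt{\langle x, x\rangle ^2 -|\langle x, \overline{x}\rangle |^2}$. With this structure $M$ is a JBW$^*$-triple. A triple isomorphism is a complex-linear bijection $T$ with $T\{a,b,c\}=\{T(a),T(b),T(c)\}$ for all $a,b,c$. A tripotent is an element $e$ with $\{e,e,e\}=e$. For a tripotent $e$, $M=M_0(e)\oplus M_1(e)\oplus M_2(e)$ where $M_k(e)=\{x\in M: \{e,e,x\}=\frac{k}{2}x\}$; the corresponding projection onto $M_k(e)$ is denoted $P_k(e)$. A tripotent $e$ is minimal if $M_2(e)=\mathbb{C}e\neq\{0\}$. $\mathcal{U}_{min}(M)$ denotes the set of minimal tripotents of $M$. For each minimal tripotent $e$ in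 a JBW$^*$-triple $M$ there is a unique extreme point $\varphi_e$ of the closed unit ball of the predual $M_*$ with $P_2(e)(x)=\varphi_e(x)e$ for all $x\in M$. For minimal tripotents $e,v$ in $M$, the triple transition pseudo-probability from $e$ to $v$ is the complex number $TTP(e,v)=\varphi_v(e)$. *)

theory Defs
  imports "HOL-Analysis.Analysis"
begin

section \<open>Complex Hilbert spaces\<close>

text \<open>The Hilbert norm, the metric and the topology are those of the underlying real Hilbert space;
  the complex inner product is linear in the first variable and has \<open>(\<bullet>)\<close> as its real part, so that
  positive definiteness is inherited from \<^class>\<open>real_inner\<close>.\<close>

class complex_hilbert = real_inner + complete_space +
  fixes scaleC :: "complex \<Rightarrow> 'a \<Rightarrow> 'a" (infixr \<open>*\<^sub>C\<close> 75)
    and cinner :: "'a \<Rightarrow> 'a \<Rightarrow> complex"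
  assumes scaleC_add_right: "a *\<^sub>C (x + y) = a *\<^sub>C x + a *\<^sub>C y"
    and scaleC_add_left: "(a + b) *\<^sub>C x = a *\<^sub>C x + b *\<^sub>C x"
    and scaleC_scaleC: "a *\<^sub>C b *\<^sub>C x = (a * b) *\<^sub>C x"
    and scaleR_eq_scaleC: "scaleR r x = complex_of_real r *\<^sub>C x"
    and cinner_commute: "cinner x y = cnj (cinner y x)"
    and cinner_add_left: "cinner (x + y) z = cinner x z + cinner y z"
    and cinner_scaleC_left: "cinner (a *\<^sub>C x) y = a * cinner x y"
    and inner_eq_Re_cinner: "inner x y = Re (cinner x y)"

global_interpretation complex_vector:
  vector_space "scaleC :: complex \<Rightarrow> 'a \<Rightarrow> 'a::complex_hilbert"
proof
  show "1 *\<^sub>C x = x" for x :: 'a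
    using scaleR_eq_scaleC[of 1 x] by simp
qed (simp_all add: scaleC_add_right scaleC_add_left scaleC_scaleC)


section \<open>Spin factors\<close>

class spin_factor = complex_hilbert +
  fixes conjugation :: "'a \<Rightarrow> 'a"
  assumes conjugation_add: "conjugation (x + y) = conjugation x + conjugation y"
    and conjugation_scaleC: "conjugation (a *\<^sub>C x) = cnj a *\<^sub>C conjugation x"
    and norm_conjugation: "norm (conjugation x) = norm x"
    and conjugation_conjugation: "conjugation (conjugation x) = x"
    \<comment> \<open>dimension at least 3, possibly infinite\<close>
    and dim_ge_3: "\<exists>x y z. \<forall>a b c. a *\<^sub>C x + b *\<^sub>C y + c *\<^sub>C z = 0 \<longrightarrow> a = 0 \<and> b = 0 \<and> c = 0"

definition triple :: "'a::spin_factor \<Rightarrow> 'a \<Rightarrow> 'a \<Rightarrow> 'a" where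
  "triple x y z =
     cinner x y *\<^sub>C z + cinner z y *\<^sub>C x - cinner x (conjugation z) *\<^sub>C conjugation y"

text \<open>Not to be confused with \<^const>\<open>norm\<close>, which is the equivalent Hilbert norm. The number
  \<open>cinner x x\<close> is real.\<close>

definition spin_norm :: "'a::spin_factor \<Rightarrow> real" where
  "spin_norm x =
     sqrt (Re (cinner x x) + sqrt ((Re (cinner x x))\<^sup>2 - (cmod (cinner x (conjugation x)))\<^sup>2))"

definition triple_isomorphism :: "('a::spin_factor \<Rightarrow> 'b::spin_factor) \<Rightarrow> bool" where
  "triple_isomorphism T \<longleftrightarrow>
     Vector_Spaces.linear scaleC scaleC T \<and> bij T \<and>
     (\<forall>a b c. T (triple a b c) = triple (T a) (T b) (T c))"


section \<open>Tripotents and Peirce decomposition\<close>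

definition tripotent :: "'a::spin_factor \<Rightarrow> bool" where
  "tripotent e \<longleftrightarrow> triple e e e = e"

definition peirce_space :: "nat \<Rightarrow> 'a::spin_factor \<Rightarrow> 'a set" where
  "peirce_space k e = {x. triple e e x = (of_nat k / 2) *\<^sub>C x}"

definition peirce_proj :: "nat \<Rightarrow> 'a::spin_factor \<Rightarrow> 'a \<Rightarrow> 'a" where
  "peirce_proj k e x =
     (THE y. \<exists>u. (\<forall>j\<le>2. u j \<in> peirce_space j e) \<and> x = (\<Sum>j\<le>2. u j) \<and> y = u k)"

definition minimal_tripotents :: "'a::spin_factor set" where
  "minimal_tripotents =
     {e. tripotent e \<and> peirce_space 2 e = range (\<lambda>c. c *\<^sub>C e) \<and> peirce_space 2 e \<noteq> {0}}"


section \<open>The predual\<close>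

definition dual_space :: "('a::spin_factor \<Rightarrow> complex) set" where
  "dual_space =
     {\<phi>. Vector_Spaces.linear scaleC (*) \<phi> \<and> (\<exists>K. \<forall>x. cmod (\<phi> x) \<le> K * spin_norm x)}"

definition dual_norm :: "('a::spin_factor \<Rightarrow> complex) \<Rightarrow> real" where
  "dual_norm \<phi> = (SUP x \<in> {x. spin_norm x \<le> 1}. cmod (\<phi> x))"

definition closed_subspace_of_dual :: "('a::spin_factor \<Rightarrow> complex) set \<Rightarrow> bool" where
  "closed_subspace_of_dual X \<longleftrightarrow>
     X \<subseteq> dual_space \<and> (\<lambda>_. 0) \<in> X \<and>
     (\<forall>\<phi>\<in>X. \<forall>\<psi>\<in>X. (\<lambda>x. \<phi> x + \<psi> x) \<in> X) \<and>
     (\<forall>\<phi>\<in>X. \<forall>c. (\<lambda>x. c * \<phi> x) \<in> X) \<and>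
     (\<forall>\<phi>\<in>dual_space. (\<forall>\<epsilon>>0. \<exists>\<psi>\<in>X. dual_norm (\<lambda>x. \<phi> x - \<psi> x) < \<epsilon>) \<longrightarrow> \<phi> \<in> X)"

definition bounded_functional_on ::
    "('a::spin_factor \<Rightarrow> complex) set \<Rightarrow> (('a \<Rightarrow> complex) \<Rightarrow> complex) \<Rightarrow> bool" where
  "bounded_functional_on X F \<longleftrightarrow>
     (\<forall>\<phi>\<in>X. \<forall>\<psi>\<in>X. F (\<lambda>x. \<phi> x + \<psi> x) = F \<phi> + F \<psi>) \<and>
     (\<forall>\<phi>\<in>X. \<forall>c. F (\<lambda>x. c * \<phi> x) = c * F \<phi>) \<and>
     (\<exists>K. \<forall>\<phi>\<in>X. cmod (F \<phi>) \<le> K * dual_norm \<phi>)"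

text \<open>A Banach space with dual \<open>M\<close> embeds canonically as a closed subspace \<open>X\<close> of the dual of \<open>M\<close>,
  and it is a predual exactly if evaluation is an isometric isomorphism of \<open>M\<close> onto the dual of
  \<open>X\<close>. The predual of a JBW*-triple is unique, hence so is \<open>X\<close>.\<close>

definition is_predual :: "('a::spin_factor \<Rightarrow> complex) set \<Rightarrow> bool" where
  "is_predual X \<longleftrightarrow>
     closed_subspace_of_dual X \<and>
     (\<forall>x. (SUP \<phi> \<in> {\<phi>\<in>X. dual_norm \<phi> \<le> 1}. cmod (\<phi> x)) = spin_norm x) \<and>
     (\<forall>F. bounded_functional_on X F \<longrightarrow> (\<exists>x. \<forall>\<phi>\<in>X. F \<phi> = \<phi> x))"

definition predual :: "('a::spin_factor \<Rightarrow> complex) set" where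
  "predual = (THE X. is_predual X)"

definition predual_ball :: "('a::spin_factor \<Rightarrow> complex) set" where
  "predual_ball = {\<phi> \<in> predual. dual_norm \<phi> \<le> 1}"

text \<open>The library's \<^const>\<open>extreme_point_of\<close> needs a \<^class>\<open>real_vector\<close> type, which
  functions into \<^typ>\<open>complex\<close> do not form.\<close>

definition extreme_functional ::
    "('a \<Rightarrow> complex) \<Rightarrow> ('a \<Rightarrow> complex) set \<Rightarrow> bool" where
  "extreme_functional \<phi> S \<longleftrightarrow>
     \<phi> \<in> S \<and>
     (\<forall>\<psi>\<in>S. \<forall>\<theta>\<in>S. \<forall>t::real. 0 < t \<and> t < 1 \<and>
        \<phi> = (\<lambda>x. of_real (1 - t) * \<psi> x + of_real t * \<theta> x) \<longrightarrow> \<psi> = \<theta>)"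


section \<open>Triple transition pseudo-probabilities\<close>

definition support_functional :: "'a::spin_factor \<Rightarrow> 'a \<Rightarrow> complex" where
  "support_functional e =
     (THE \<phi>. extreme_functional \<phi> predual_ball \<and> (\<forall>x. peirce_proj 2 e x = \<phi> x *\<^sub>C e))"

text \<open>\<open>TTP e v\<close> is the transition pseudo-probability from \<open>e\<close> to \<open>v\<close>: the functional belongs to
  the second argument.\<close>

definition TTP :: "'a::spin_factor \<Rightarrow> 'a \<Rightarrow> complex" where
  "TTP e v = support_functional v e"

end

theory Submission
  imports Defs
begin

text \<open>Every functional bounded for the spin norm is given by a vector of the Hilbert space \<open>M\<close>, and
  \<open>M\<close> is reflexive, so its predual is its Hilbert dual. A minimal tripotent is a vector \<open>e\<close> with
  \<open>cinner e e = 1/2\<close> and \<open>cinner e (conjugation e) = 0\<close>, its support functional is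
  \<open>2 * cinner x e\<close>, and therefore transition pseudo-probabilities are inner products up to the
  factor 2. As the minimal tripotents span \<open>M\<close>, a bijection preserving these inner products
  extends uniquely to a linear surjective isometry of Hilbert spaces. It maps the null cone of
  \<open>cinner x (conjugation x)\<close> to that of the target, which forces it to respect the conjugations up to
  a unimodular factor, and the triple product does not see this factor.\<close>

section \<open>Complex Hilbert spaces\<close>

lemma cinner_add_right: "cinner x (y + z) = cinner x y + cinner x (z::'a::complex_hilbert)"
  by (metis cinner_add_left cinner_commute complex_cnj_add)

lemma cinner_scaleC_right: "cinner x (a *\<^sub>C y) = cnj a * cinner x (y::'a::complex_hilbert)"
  by (metis cinner_commute cinner_scaleC_left complex_cnj_mult)

lemma cinner_zero_left [simp]: "cinner 0 (y::'a::complex_hilbert) = 0"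
  using cinner_add_left[of 0 0 y] by simp

lemma cinner_zero_right [simp]: "cinner (y::'a::complex_hilbert) 0 = 0"
  using cinner_add_right[of y 0 0] by simp

lemma cinner_minus_left: "cinner (- x) (y::'a::complex_hilbert) = - cinner x y"
  using cinner_add_left[of x "- x" y] by (simp add: eq_neg_iff_add_eq_0 add.commute)

lemma cinner_minus_right: "cinner x (- y::'a::complex_hilbert) = - cinner x y"
  using cinner_add_right[of x y "- y"] by (simp add: eq_neg_iff_add_eq_0 add.commute)

lemma cinner_diff_left: "cinner (x - y) (z::'a::complex_hilbert) = cinner x z - cinner y z"
  using cinner_add_left[of x "- y" z] by (simp add: cinner_minus_left)

lemma cinner_diff_right: "cinner x (y - z::'a::complex_hilbert) = cinner x y - cinner x z"
  using cinner_add_right[of x y "- z"] by (simp add: cinner_minus_right)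

lemmas cinner_simps = cinner_add_left cinner_add_right cinner_scaleC_left cinner_scaleC_right
  cinner_minus_left cinner_minus_right cinner_diff_left cinner_diff_right

lemma cinner_self: "cinner x x = complex_of_real ((norm (x::'a::complex_hilbert))\<^sup>2)"
proof (rule complex_eqI)
  show "Re (cinner x x) = Re (complex_of_real ((norm x)\<^sup>2))"
    by (simp add: inner_eq_Re_cinner[symmetric] power2_norm_eq_inner)
  show "Im (cinner x x) = Im (complex_of_real ((norm x)\<^sup>2))"
    using arg_cong[OF cinner_commute[of x x], of Im] by simp
qed

lemma norm_scaleC: "norm (c *\<^sub>C (x::'a::complex_hilbert)) = cmod c * norm x"
proof -
  have "cinner (c *\<^sub>C x) (c *\<^sub>C x) = (c * cnj c) * cinner x x"
    by (simp add: cinner_simps mult.assoc)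
  hence "complex_of_real ((norm (c *\<^sub>C x))\<^sup>2) = complex_of_real ((cmod c * norm x)\<^sup>2)"
    by (simp add: cinner_self complex_norm_square[symmetric] power_mult_distrib)
  hence "(norm (c *\<^sub>C x))\<^sup>2 = (cmod c * norm x)\<^sup>2"
    using of_real_eq_iff by blast
  thus ?thesis by (simp add: power2_eq_iff_nonneg)
qed

text \<open>A unimodular factor on \<open>x\<close> makes the inner product real and nonnegative, so
  the real Cauchy-Schwarz inequality applies.\<close>

lemma cmod_cinner_le: "cmod (cinner x y) \<le> norm x * norm (y::'a::complex_hilbert)"
proof (cases "cinner x y = 0")
  case False
  define c where "c = cnj (cinner x y) / cmod (cinner x y)"
  have c: "cmod c = 1" using False by (simp add: c_def norm_divide)
  have "cinner (c *\<^sub>C x) y = cmod (cinner x y)"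
    using False
    by (simp add: cinner_simps c_def field_simps)
      (simp add: complex_norm_square[symmetric] power2_eq_square mult.commute)
  hence "cmod (cinner x y) = inner (c *\<^sub>C x) y"
    by (simp add: inner_eq_Re_cinner)
  also have "\<dots> \<le> norm (c *\<^sub>C x) * norm y" by (rule norm_cauchy_schwarz)
  finally show ?thesis by (simp add: norm_scaleC c)
qed simp

lemma cinner_eqI: "(\<And>z. cinner x z = cinner y z) \<Longrightarrow> x = (y::'a::complex_hilbert)"
  using cinner_self[of "x - y"] by (auto simp: cinner_diff_left)

lemma cinner_eqI_right: "(\<And>z. cinner z x = cinner z y) \<Longrightarrow> x = (y::'a::complex_hilbert)"
  by (metis cinner_eqI cinner_commute)

section \<open>Orthogonal projection and Riesz representation\<close>

text \<open>Projection theorem: a minimising sequence for the distance from \<open>x\<close> to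
  \<open>S\<close> is Cauchy, and the error \<open>x - l\<close> at its limit is orthogonal to
  \<open>S\<close>.\<close>

lemma closed_subspace_orthogonal:
  fixes S :: "'a::complex_hilbert set"
  assumes S: "complex_vector.subspace S" and cl: "closed S" and "x \<notin> S"
  obtains z where "z \<noteq> 0" "\<And>s. s \<in> S \<Longrightarrow> cinner z s = 0"
proof -
  have add: "u + v \<in> S" and scale: "c *\<^sub>C u \<in> S" if "u \<in> S" "v \<in> S" for u v c
    using S that by (auto simp: complex_vector.subspace_def)
  have zero: "0 \<in> S" using S by (auto simp: complex_vector.subspace_def)
  define D where "D = (INF s\<in>S. (norm (x - s))\<^sup>2)"
  have bdd: "bdd_below ((\<lambda>s. (norm (x - s))\<^sup>2) ` S)"
    by (rule bdd_belowI[of _ 0]) auto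
  have D: "D \<le> (norm (x - s))\<^sup>2" if "s \<in> S" for s
    unfolding D_def by (rule cINF_lower[OF bdd that])
  have "\<exists>s\<in>S. (norm (x - s))\<^sup>2 < D + 1 / real (Suc n)" for n
    using cINF_less_iff[OF _ bdd, of "D + 1 / real (Suc n)"] zero
    by (auto simp: D_def)
  then obtain s where sS: "s n \<in> S" and s: "(norm (x - s n))\<^sup>2 < D + 1 / real (Suc n)" for n
    by metis
  have par: "(norm (s m - s n))\<^sup>2 \<le> 2 / real (Suc m) + 2 / real (Suc n)" for m n
  proof -
    have "(1/2) *\<^sub>C (s m + s n) \<in> S" using sS add scale by blast
    from D[OF this] have "D \<le> (norm (x - (1/2) *\<^sub>R (s m + s n)))\<^sup>2"
      by (simp add: scaleR_eq_scaleC)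
    \<comment> \<open>The parallelogram law for \<open>x - s m\<close> and \<open>x - s n\<close>;
      their half sum is the distance vector to the midpoint, which lies in \<open>S\<close>.\<close>
    moreover have "(norm (s m - s n))\<^sup>2 + 4 * (norm (x - (1/2) *\<^sub>R (s m + s n)))\<^sup>2
      = 2 * (norm (x - s m))\<^sup>2 + 2 * (norm (x - s n))\<^sup>2"
      unfolding power2_norm_eq_inner by (simp add: inner_simps inner_commute algebra_simps)
    ultimately show ?thesis using s[of m] s[of n] by simp
  qed
  have "Cauchy s"
  proof (rule metric_CauchyI)
    fix e :: real assume e: "0 < e"
    obtain N where N: "4 / e\<^sup>2 < real N" using reals_Archimedean2 by blast
    have "dist (s m) (s n) < e" if "m \<ge> N" "n \<ge> N" for m n
    proof -
      have "2 / real (Suc k) < e\<^sup>2 / 2" if "k \<ge> N" for k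
      proof -
        have "4 / e\<^sup>2 < real (Suc k)" using N that by linarith
        thus ?thesis using e by (simp add: field_simps)
      qed
      from this[OF \<open>m \<ge> N\<close>] this[OF \<open>n \<ge> N\<close>] have "(norm (s m - s n))\<^sup>2 < e\<^sup>2"
        using par[of m n] by linarith
      thus ?thesis using e by (simp add: dist_norm power2_less_imp_less)
    qed
    thus "\<exists>M. \<forall>m\<ge>M. \<forall>n\<ge>M. dist (s m) (s n) < e" by blast
  qed
  then obtain l where l: "s \<longlonglongrightarrow> l" using Cauchy_convergent convergent_def by blast
  have lS: "l \<in> S" using closed_sequentially[OF cl] sS l by blast
  have "(\<lambda>n. (norm (x - s n))\<^sup>2) \<longlonglongrightarrow> (norm (x - l))\<^sup>2"
    by (intro tendsto_intros l)
  moreover have "(\<lambda>n. D + 1 / real (Suc n)) \<longlonglongrightarrow> D + 0"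
    by (intro tendsto_intros LIMSEQ_Suc lim_1_over_n)
  ultimately have lD: "(norm (x - l))\<^sup>2 \<le> D"
    using s by (auto intro: LIMSEQ_le less_imp_le)
  define z where "z = x - l"
  have re: "inner z u = 0" if u: "u \<in> S" for u
  proof -
    \<comment> \<open>First variation: moving the nearest point \<open>l\<close> by \<open>t\<close>
      times \<open>u\<close> stays in \<open>S\<close> and cannot shorten the distance.\<close>
    have *: "2 * t * inner z u \<le> t\<^sup>2 * (norm u)\<^sup>2" for t :: real
    proof -
      have "l + complex_of_real t *\<^sub>C u \<in> S" using add lS scale u by blast
      from order.trans[OF lD D[OF this]] have "(norm z)\<^sup>2 \<le> (norm (z - t *\<^sub>R u))\<^sup>2"
        by (simp only: z_def scaleR_eq_scaleC diff_diff_eq)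
      thus ?thesis
        unfolding power2_norm_eq_inner
        by (simp add: inner_simps inner_commute algebra_simps power2_eq_square)
    qed
    show ?thesis
    proof (cases "u = 0")
      case False
      \<comment> \<open>This \<open>t\<close> minimises the difference of the two sides of
        \<open>*\<close>.\<close>
      from *[of "inner z u / (norm u)\<^sup>2"] have "(inner z u)\<^sup>2 \<le> 0"
        using False by (simp add: field_simps power2_eq_square)
      thus ?thesis by simp
    qed simp
  qed
  have "cinner z u = 0" if u: "u \<in> S" for u
  proof (rule complex_eqI)
    show "Re (cinner z u) = Re 0" using re[OF u] by (simp add: inner_eq_Re_cinner)
    show "Im (cinner z u) = Im 0"
      \<comment> \<open>Multiplying \<open>u\<close> by \<i> turns the imaginary part into a real
        one.\<close>
      using re[OF scale[OF u u, of \<i>]] by (simp add: inner_eq_Re_cinner cinner_simps)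
  qed
  moreover have "z \<noteq> 0" using lS \<open>x \<notin> S\<close> by (auto simp: z_def)
  ultimately show ?thesis using that by blast
qed

text \<open>The kernel of a bounded functional is closed. A nonzero vector \<open>z\<close>
  orthogonal to it represents the functional up to a scalar, which is found by evaluating at
  \<open>z\<close>.\<close>

theorem riesz_representation:
  fixes f :: "'a::complex_hilbert \<Rightarrow> complex"
  assumes lin: "Vector_Spaces.linear scaleC (*) f" and bdd: "\<And>x. cmod (f x) \<le> K * norm x"
  obtains y where "f = (\<lambda>x. cinner x y)"
proof -
  interpret Vector_Spaces.linear scaleC "(*)" f by fact
  show ?thesis
  proof (cases "\<forall>x. f x = 0")
    case True
    thus ?thesis using that[of 0] by auto
  next
    case False
    then obtain x0 where x0: "f x0 \<noteq> 0" by blast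
    define S where "S = {x. f x = 0}"
    have sub: "complex_vector.subspace S"
      by (auto simp: S_def complex_vector.subspace_def add scale)
    have "bounded_linear f"
      by (rule bounded_linear_intro[of _ K])
        (auto simp: add scale scaleR_eq_scaleC scaleR_conv_of_real bdd mult.commute)
    hence "continuous_on UNIV f" by (simp add: linear_continuous_on)
    hence "closed S" unfolding S_def by (intro closed_Collect_eq) auto
    from closed_subspace_orthogonal[OF sub this, of x0] x0
    obtain z where z: "z \<noteq> 0" "\<And>s. s \<in> S \<Longrightarrow> cinner z s = 0" by (auto simp: S_def)
    have fz: "f z \<noteq> 0" using z(2)[of z] z(1) by (auto simp: S_def cinner_self)
    have nz: "cinner z z \<noteq> 0" using z by (simp add: cinner_self)
    have eq: "f x = cinner x ((cnj (f z) / cnj (cinner z z)) *\<^sub>C z)" for x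
    proof -
      \<comment> \<open>This combination of \<open>x\<close> and \<open>z\<close> lies in the
        kernel, hence is orthogonal to \<open>z\<close>; solving for \<open>f x\<close> gives the
        formula.\<close>
      have "f (f z *\<^sub>C x - f x *\<^sub>C z) = 0" by (simp add: diff scale)
      hence "cinner z (f z *\<^sub>C x - f x *\<^sub>C z) = 0" using z(2) by (simp add: S_def)
      hence "cinner (f z *\<^sub>C x - f x *\<^sub>C z) z = 0" by (metis cinner_commute complex_cnj_zero)
      thus ?thesis using nz by (simp add: cinner_simps field_simps)
    qed
    thus ?thesis by (intro that) auto
  qed
qed

section \<open>The spin norm\<close>

lemma conjugation_zero [simp]: "conjugation (0::'a::spin_factor) = 0"
  using conjugation_add[of 0 "0::'a"] by simp

lemma conjugation_minus: "conjugation (- x) = - conjugation (x::'a::spin_factor)"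
  using conjugation_add[of x "- x"] by (simp add: eq_neg_iff_add_eq_0 add.commute)

lemma conjugation_diff: "conjugation (x - y) = conjugation x - conjugation (y::'a::spin_factor)"
  using conjugation_add[of x "- y"] by (simp add: conjugation_minus)

lemmas conjugation_simps = conjugation_add conjugation_minus conjugation_diff conjugation_scaleC
  conjugation_conjugation

text \<open>By polarisation the isometry preserves the real inner product; conjugate-linearity,
  tested on \<i> times \<open>x\<close>, flips the imaginary part.\<close>

lemma cinner_conjugation: "cinner (conjugation x) (conjugation y) = cinner y (x::'a::spin_factor)"
proof -
  have inn: "inner (conjugation u) (conjugation v) = inner u v" for u v :: 'a
    unfolding dot_norm conjugation_add[symmetric] norm_conjugation ..
  have "cinner (conjugation x) (conjugation y) = cnj (cinner x y)"
  proof (rule complex_eqI)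
    show "Re (cinner (conjugation x) (conjugation y)) = Re (cnj (cinner x y))"
      using inn[of x y] by (simp add: inner_eq_Re_cinner)
    show "Im (cinner (conjugation x) (conjugation y)) = Im (cnj (cinner x y))"
      using inn[of "\<i> *\<^sub>C x" y]
      by (simp add: inner_eq_Re_cinner conjugation_simps cinner_simps)
  qed
  thus ?thesis by (metis cinner_commute)
qed

lemma cinner_conjugation_right: "cinner x (conjugation y) = cinner y (conjugation (x::'a::spin_factor))"
  using cinner_conjugation[of "conjugation x" y] by (simp add: conjugation_conjugation)

lemma cinner_conjugation_left: "cinner (conjugation x) y = cinner (conjugation y) (x::'a::spin_factor)"
  using cinner_conjugation[of x "conjugation y"] by (simp add: conjugation_conjugation)

lemma cmod_cinner_conjugation_le: "cmod (cinner x (conjugation x)) \<le> (norm (x::'a::spin_factor))\<^sup>2"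
  using cmod_cinner_le[of x "conjugation x"] by (simp add: norm_conjugation power2_eq_square)

section \<open>Comparison of the spin norm with the Hilbert norm\<close>

lemma spin_norm_radicand_nonneg:
  "0 \<le> ((norm x)\<^sup>2)\<^sup>2 - (cmod (cinner x (conjugation (x::'a::spin_factor))))\<^sup>2"
  using power_mono[OF cmod_cinner_conjugation_le[of x], of 2] by simp

lemma spin_norm_power2:
  "(spin_norm x)\<^sup>2 = (norm x)\<^sup>2 + sqrt (((norm x)\<^sup>2)\<^sup>2 - (cmod (cinner x (conjugation x)))\<^sup>2)"
  for x :: "'a::spin_factor"
  unfolding spin_norm_def cinner_self Re_complex_of_real
  by (rule real_sqrt_pow2) (use spin_norm_radicand_nonneg[of x] in simp)

lemma spin_norm_nonneg [simp]: "0 \<le> spin_norm (x::'a::spin_factor)"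
  unfolding spin_norm_def cinner_self Re_complex_of_real
  using spin_norm_radicand_nonneg[of x] by simp

text \<open>Together with \<open>spin_norm_le\<close> this makes the two norms equivalent, so that
  they admit the same bounded functionals.\<close>

lemma norm_le_spin_norm: "norm x \<le> spin_norm (x::'a::spin_factor)"
  by (rule power2_le_imp_le)
    (use spin_norm_radicand_nonneg[of x] in \<open>simp_all add: spin_norm_power2\<close>)

lemma spin_norm_le: "(spin_norm x)\<^sup>2 \<le> 2 * (norm (x::'a::spin_factor))\<^sup>2"
proof -
  have "sqrt (((norm x)\<^sup>2)\<^sup>2 - (cmod (cinner x (conjugation x)))\<^sup>2) \<le> sqrt (((norm x)\<^sup>2)\<^sup>2)"
    by (rule real_sqrt_le_mono) simp
  thus ?thesis unfolding spin_norm_power2 real_sqrt_abs abs_power2 by linarith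
qed

lemma spin_norm_zero [simp]: "spin_norm (0::'a::spin_factor) = 0"
  by (simp add: spin_norm_def)

lemma spin_norm_eq_zero: "spin_norm x = 0 \<longleftrightarrow> x = (0::'a::spin_factor)"
  using norm_le_spin_norm[of x] by auto

lemma spin_norm_scaleC: "spin_norm (c *\<^sub>C x) = cmod c * spin_norm (x::'a::spin_factor)"
proof -
  have "(spin_norm (c *\<^sub>C x))\<^sup>2 = (cmod c * spin_norm x)\<^sup>2"
  proof -
    have "sqrt (((norm (c *\<^sub>C x))\<^sup>2)\<^sup>2 - (cmod (cinner (c *\<^sub>C x) (conjugation (c *\<^sub>C x))))\<^sup>2)
      = sqrt (((cmod c)\<^sup>2)\<^sup>2 * (((norm x)\<^sup>2)\<^sup>2 - (cmod (cinner x (conjugation x)))\<^sup>2))"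
      by (simp add: norm_scaleC conjugation_simps cinner_simps norm_mult power2_eq_square algebra_simps)
    also have "\<dots> = (cmod c)\<^sup>2 * sqrt (((norm x)\<^sup>2)\<^sup>2 - (cmod (cinner x (conjugation x)))\<^sup>2)"
      by (simp only: real_sqrt_mult real_sqrt_abs abs_power2)
    finally show ?thesis
      by (simp add: spin_norm_power2 power_mult_distrib norm_scaleC algebra_simps)
  qed
  thus ?thesis by (simp add: power2_eq_iff_nonneg)
qed

lemma cmod_cinner_le_spin_norm: "cmod (cinner x y) \<le> norm y * spin_norm (x::'a::spin_factor)"
  using cmod_cinner_le[of x y] mult_left_mono[OF norm_le_spin_norm[of x], of "norm y"]
  by (simp add: mult.commute)

section \<open>Null vectors and norming functionals\<close>

text \<open>A metric description of the minimal tripotents, justified in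
  \<open>minimal_tripotents_iff\<close>; \<open>e\<close> and \<open>conjugation e\<close> are then
  orthogonal of the same length.\<close>

definition unit_null :: "'a::spin_factor \<Rightarrow> bool" where
  "unit_null e \<longleftrightarrow> cinner e e = 1/2 \<and> cinner e (conjugation e) = 0"

lemma unit_null_simps:
  assumes "unit_null e"
  shows "cinner e e = 1/2" "cinner e (conjugation e) = 0" "cinner (conjugation e) e = 0"
    "cinner (conjugation e) (conjugation e) = 1/2"
  using assms unfolding unit_null_def
  by (auto simp: cinner_conjugation) (metis cinner_commute complex_cnj_zero)

lemma unit_null_norm: "unit_null e \<Longrightarrow> (norm e)\<^sup>2 = 1/2"
  using unit_null_simps(1)[of e] cinner_self[of e]
  by (metis Re_complex_of_real Re_divide_numeral one_complex.sel(1))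

text \<open>This places the functional \<open>2 * cinner x e\<close> in the dual unit ball.
  Splitting \<open>x\<close> along \<open>e\<close>, \<open>conjugation e\<close> and a rest
  \<open>w\<close> orthogonal to both reduces it to an inequality between the real numbers
  \<open>A\<close>, \<open>B\<close> and \<open>W\<close>.\<close>

lemma cmod_cinner_unit_null_le:
  assumes e: "unit_null (e::'a::spin_factor)"
  shows "2 * cmod (cinner x e) \<le> spin_norm x"
proof -
  define \<alpha> \<beta> where "\<alpha> = 2 * cinner x e" and "\<beta> = 2 * cinner x (conjugation e)"
  define w where "w = x - \<alpha> *\<^sub>C e - \<beta> *\<^sub>C conjugation e"
  note s = unit_null_simps[OF e]
  have x: "x = \<alpha> *\<^sub>C e + \<beta> *\<^sub>C conjugation e + w" by (simp add: w_def)
  have we: "cinner w e = 0" and wc: "cinner w (conjugation e) = 0"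
    by (simp_all add: w_def cinner_simps s \<alpha>_def \<beta>_def)
  have ew: "cinner e w = 0" "cinner (conjugation e) w = 0"
    using we wc by (metis cinner_commute complex_cnj_zero)+
  have cw: "cinner e (conjugation w) = 0" "cinner (conjugation e) (conjugation w) = 0"
    using we wc by (simp_all add: cinner_conjugation cinner_conjugation_right[of e])
  define A B W where "A = cmod \<alpha>" and "B = cmod \<beta>" and "W = (norm w)\<^sup>2"
  define a where "a = (norm x)\<^sup>2"
  have "cinner x x = \<alpha> * cnj \<alpha> / 2 + \<beta> * cnj \<beta> / 2 + cinner w w"
    by (subst (1 2) x) (simp add: cinner_simps s we wc ew mult.commute)
  also have "\<dots> = complex_of_real (A\<^sup>2 / 2 + B\<^sup>2 / 2 + W)"
    by (simp add: cinner_self complex_norm_square[symmetric] A_def B_def W_def)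
  finally have a: "a = A\<^sup>2 / 2 + B\<^sup>2 / 2 + W"
    unfolding cinner_self of_real_eq_iff a_def .
  have "cinner x (conjugation x) = \<alpha> * \<beta> + cinner w (conjugation w)"
    by (subst (1 2) x) (simp add: cinner_simps conjugation_simps s we wc cw)
  hence q: "cmod (cinner x (conjugation x)) \<le> A * B + W"
    using norm_triangle_ineq[of "\<alpha> * \<beta>" "cinner w (conjugation w)"] cmod_cinner_conjugation_le[of w]
    by (simp add: norm_mult A_def B_def W_def)
  have pos: "0 \<le> A" "0 \<le> B" "0 \<le> W" by (simp_all add: A_def B_def W_def)
  have "A\<^sup>2 \<le> a + sqrt (a\<^sup>2 - (cmod (cinner x (conjugation x)))\<^sup>2)"
  proof (cases "A\<^sup>2 \<le> a")
    case True
    thus ?thesis using spin_norm_radicand_nonneg[of x]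
      by (simp add: a_def add_increasing2)
  next
    case False
    hence BA: "(A - B) * (A + B) \<ge> 2 * W" by (simp add: a power2_eq_square algebra_simps)
    have "B \<le> A"
    proof (rule power2_le_imp_le)
      show "B\<^sup>2 \<le> A\<^sup>2" using False pos(3) unfolding a by linarith
    qed (rule pos)
    hence "(A - B) * (A + B) \<le> (A - B) * (2 * A)" using pos by (intro mult_left_mono) auto
    with BA have "2 * A\<^sup>2 - 2 * (A * B) - 2 * W \<ge> 0"
      by (simp add: power2_eq_square algebra_simps)
    \<comment> \<open>Once \<open>a\<close> is expanded, this product is exactly the difference of
      the two sides of the next inequality.\<close>
    hence "0 \<le> W * (2 * A\<^sup>2 - 2 * (A * B) - W)" using pos by (intro mult_nonneg_nonneg) auto
    hence "(A\<^sup>2 - a)\<^sup>2 \<le> a\<^sup>2 - (A * B + W)\<^sup>2"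
      by (simp add: a power2_eq_square field_simps)
    also have "\<dots> \<le> a\<^sup>2 - (cmod (cinner x (conjugation x)))\<^sup>2"
      using power_mono[OF q, of 2] by simp
    finally have "A\<^sup>2 - a \<le> sqrt (a\<^sup>2 - (cmod (cinner x (conjugation x)))\<^sup>2)"
      by (rule real_le_rsqrt)
    thus ?thesis by simp
  qed
  hence "A\<^sup>2 \<le> (spin_norm x)\<^sup>2" by (simp add: spin_norm_power2 a_def)
  hence "A \<le> spin_norm x" by (rule power2_le_imp_le) simp
  thus ?thesis by (simp add: A_def \<alpha>_def norm_mult)
qed

text \<open>The homogeneous form of the preceding bound: dividing \<open>f\<close> by
  \<open>sqrt 2 * norm f\<close> gives it the length of a minimal tripotent.\<close>

lemma cmod_cinner_null_le:
  assumes f: "cinner f (conjugation f) = 0"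
  shows "sqrt 2 * cmod (cinner x f) \<le> norm f * spin_norm (x::'a::spin_factor)"
proof (cases "f = 0")
  case False
  define r where "r = 1 / (sqrt 2 * norm f)"
  have r: "r > 0" using False by (simp add: r_def)
  have "unit_null (complex_of_real r *\<^sub>C f)"
  proof -
    have "r\<^sup>2 * (norm f)\<^sup>2 = 1/2"
      using False by (simp add: r_def power_divide power_mult_distrib)
    hence "(norm (complex_of_real r *\<^sub>C f))\<^sup>2 = 1/2"
      by (simp add: norm_scaleC power_mult_distrib)
    hence "cinner (complex_of_real r *\<^sub>C f) (complex_of_real r *\<^sub>C f) = 1/2"
      by (simp only: cinner_self) simp
    moreover have "cinner (complex_of_real r *\<^sub>C f) (conjugation (complex_of_real r *\<^sub>C f)) = 0"
      by (simp add: cinner_simps conjugation_simps f)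
    ultimately show ?thesis unfolding unit_null_def by blast
  qed
  from cmod_cinner_unit_null_le[OF this, of x]
  have *: "2 * (r * cmod (cinner x f)) \<le> spin_norm x"
    using r by (simp add: cinner_simps norm_mult)
  have "2 * r * norm f = sqrt 2" using False by (simp add: r_def real_div_sqrt)
  hence "sqrt 2 * cmod (cinner x f) = (2 * (r * cmod (cinner x f))) * norm f"
    by (metis mult.assoc mult.commute)
  also have "\<dots> \<le> spin_norm x * norm f" using * by (intro mult_right_mono) auto
  finally show ?thesis by (simp add: mult.commute)
qed simp

text \<open>The norming vector is the Hilbert space one when \<open>x\<close> is a multiple of a self-conjugate vector;
  otherwise it is the dominant minimal tripotent in the spectral decomposition of \<open>x\<close>, which is a
  multiple of \<open>(spin_norm x)\<^sup>2 *\<^sub>C x - cinner x (conjugation x) *\<^sub>C conjugation x\<close>.\<close>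

lemma spin_norm_attained:
  fixes x :: "'a::spin_factor"
  obtains y where "\<And>z. cmod (cinner z y) \<le> spin_norm z" "cmod (cinner x y) = spin_norm x"
proof (cases "x = 0")
  case True
  thus ?thesis using that[of 0] by simp
next
  case x0: False
  define a where "a = (norm x)\<^sup>2"
  define b where "b = cinner x (conjugation x)"
  define s where "s = (spin_norm x)\<^sup>2"
  have s: "s = a + sqrt (a\<^sup>2 - (cmod b)\<^sup>2)" by (simp add: s_def a_def b_def spin_norm_power2)
  have le: "cmod b \<le> a" using cmod_cinner_conjugation_le[of x] by (simp add: a_def b_def)
  show ?thesis
  proof (cases "cmod b = a")
    case True
    hence "spin_norm x = norm x" using s by (simp add: s_def a_def power2_eq_iff_nonneg)
    define y where "y = complex_of_real (1 / norm x) *\<^sub>C x"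
    have "norm y = 1" using x0 by (simp add: y_def norm_scaleC norm_divide)
    moreover have "cmod (cinner x y) = norm x"
      using x0 by (simp add: y_def cinner_simps cinner_self norm_divide norm_mult power2_eq_square
          flip: of_real_mult)
    ultimately show ?thesis
      using that[of y] cmod_cinner_le_spin_norm[of _ y] \<open>spin_norm x = norm x\<close> by simp
  next
    case False
    hence "(cmod b)\<^sup>2 < a\<^sup>2" using le by (simp add: power_strict_mono)
    hence sa: "s > a" using s by simp
    have a0: "a > 0" using x0 by (simp add: a_def)
    have "(s - a)\<^sup>2 = a\<^sup>2 - (cmod b)\<^sup>2" using s \<open>(cmod b)\<^sup>2 < a\<^sup>2\<close> by simp
    \<comment> \<open>\<open>s\<close> is the larger root of a quadratic with coefficients given by
      \<open>a\<close> and \<open>cmod b\<close>; this relation is what makes \<open>f\<close> below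
      a null vector.\<close>
    hence b2: "(cmod b)\<^sup>2 = 2 * a * s - s\<^sup>2" by (simp add: power2_eq_square algebra_simps)
    have bb: "b * cnj b = complex_of_real (2 * a * s - s\<^sup>2)"
      by (simp only: complex_norm_square[symmetric] b2 flip: of_real_power)
    define f where "f = complex_of_real s *\<^sub>C x - b *\<^sub>C conjugation x"
    have xx: "cinner x x = a" "cinner (conjugation x) (conjugation x) = a"
      by (simp_all add: cinner_self a_def norm_conjugation)
    have xb: "cinner x (conjugation x) = b" "cinner (conjugation x) x = cnj b"
      unfolding b_def by (rule refl, rule cinner_commute)
    have "cinner f (conjugation f) = b * (s * s - 2 * a * s + b * cnj b)"
      by (simp add: f_def cinner_simps conjugation_simps xx xb algebra_simps)
    hence f0: "cinner f (conjugation f) = 0"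
      unfolding bb by (simp add: power2_eq_square algebra_simps)
    have "cinner x f = s * a - b * cnj b"
      by (simp add: f_def cinner_simps xx xb algebra_simps)
    hence "cinner x f = complex_of_real (s * (s - a))"
      unfolding bb by (simp add: power2_eq_square algebra_simps)
    hence xf: "cmod (cinner x f) = s * (s - a)"
      using sa a0 by (simp add: norm_mult flip: of_real_diff of_real_mult)
    have "cinner f f = s * s * a - 2 * s * (b * cnj b) + (b * cnj b) * a"
      by (simp add: f_def cinner_simps xx xb algebra_simps)
    hence "cinner f f = complex_of_real (2 * s * (s - a)\<^sup>2)"
      unfolding bb by (simp add: power2_eq_square algebra_simps)
    hence nf: "(norm f)\<^sup>2 = 2 * s * (s - a)\<^sup>2"
      unfolding cinner_self of_real_eq_iff .
    have f_ne: "norm f \<noteq> 0" using nf sa a0 by auto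
    have nf': "norm f = sqrt 2 * spin_norm x * (s - a)"
    proof -
      have "(norm f)\<^sup>2 = (sqrt 2 * spin_norm x * (s - a))\<^sup>2"
        by (simp add: nf s_def power_mult_distrib)
      thus ?thesis using sa by (subst (asm) power2_eq_iff_nonneg) auto
    qed
    \<comment> \<open>Rescaling to Hilbert norm \<open>sqrt 2\<close> turns
      \<open>cmod_cinner_null_le\<close> into the required bound with constant 1.\<close>
    define y where "y = complex_of_real (sqrt 2 / norm f) *\<^sub>C f"
    have "cmod (cinner z y) \<le> spin_norm z" for z
      using cmod_cinner_null_le[OF f0, of z] f_ne
      by (simp add: y_def cinner_simps norm_mult norm_divide field_simps)
    moreover have "cmod (cinner x y) = spin_norm x"
    proof -
      have "cmod (cinner x y) = sqrt 2 * (s * (s - a)) / norm f"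
        by (simp add: y_def cinner_simps norm_mult norm_divide xf)
      also have "\<dots> = s / spin_norm x"
        using sa x0 by (simp add: nf' spin_norm_eq_zero)
      also have "\<dots> = spin_norm x" by (simp add: s_def power2_eq_square)
      finally show ?thesis .
    qed
    ultimately show ?thesis by (rule that)
  qed
qed

section \<open>The predual of a spin factor\<close>

lemma dual_norm_cinner_le: "dual_norm (\<lambda>x. cinner x y) \<le> norm (y::'a::spin_factor)"
  unfolding dual_norm_def
proof (rule cSUP_least)
  show "{x::'a. spin_norm x \<le> 1} \<noteq> {}" by (auto intro: exI[of _ 0])
  show "cmod (cinner x y) \<le> norm y" if "x \<in> {x. spin_norm x \<le> 1}" for x
    using cmod_cinner_le_spin_norm[of x y] mult_left_mono[of "spin_norm x" 1 "norm y"] that by simp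
qed

lemma cmod_le_dual_norm:
  assumes "\<phi> \<in> dual_space"
  shows "cmod (\<phi> x) \<le> dual_norm \<phi> * spin_norm (x::'a::spin_factor)"
proof -
  obtain K where lin: "Vector_Spaces.linear scaleC (*) \<phi>" and K: "\<And>x. cmod (\<phi> x) \<le> K * spin_norm x"
    using assms by (auto simp: dual_space_def)
  interpret Vector_Spaces.linear scaleC "(*)" \<phi> by fact
  \<comment> \<open>The real supremum defining \<open>dual_norm\<close> is an upper bound only once
    the set is known to be bounded above.\<close>
  have bdd: "bdd_above ((\<lambda>x. cmod (\<phi> x)) ` {x. spin_norm x \<le> 1})"
  proof (rule bdd_aboveI2)
    fix x :: 'a assume "x \<in> {x. spin_norm x \<le> 1}"
    hence "K * spin_norm x \<le> \<bar>K\<bar> * 1" by (intro mult_mono) auto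
    thus "cmod (\<phi> x) \<le> \<bar>K\<bar>" using K[of x] by simp
  qed
  show ?thesis
  proof (cases "x = 0")
    case True
    thus ?thesis by (simp add: zero)
  next
    case False
    hence s: "spin_norm x > 0" using spin_norm_eq_zero[of x] spin_norm_nonneg[of x] by linarith
    let ?y = "complex_of_real (1 / spin_norm x) *\<^sub>C x"
    have "spin_norm ?y = 1" using s by (simp add: spin_norm_scaleC norm_divide)
    hence "cmod (\<phi> ?y) \<le> dual_norm \<phi>"
      unfolding dual_norm_def by (intro cSUP_upper[OF _ bdd]) simp
    thus ?thesis using s by (simp add: scale norm_mult norm_divide field_simps)
  qed
qed

text \<open>Equivalence of the spin and Hilbert norms reduces this to the Riesz
  representation.\<close>

lemma dual_space_eq: "dual_space = range (\<lambda>y (x::'a::spin_factor). cinner x y)"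
proof (intro equalityI subsetI)
  fix \<phi> :: "'a \<Rightarrow> complex" assume "\<phi> \<in> dual_space"
  then obtain K where lin: "Vector_Spaces.linear scaleC (*) \<phi>" and K: "\<And>x. cmod (\<phi> x) \<le> K * spin_norm x"
    by (auto simp: dual_space_def)
  have "cmod (\<phi> x) \<le> (\<bar>K\<bar> * sqrt 2) * norm x" for x
  proof -
    have "(spin_norm x)\<^sup>2 \<le> (sqrt 2 * norm x)\<^sup>2"
      using spin_norm_le[of x] by (simp add: power_mult_distrib)
    hence "spin_norm x \<le> sqrt 2 * norm x" by (rule power2_le_imp_le) simp
    hence "K * spin_norm x \<le> \<bar>K\<bar> * (sqrt 2 * norm x)" by (intro mult_mono) auto
    with K[of x] show ?thesis by (simp add: mult.assoc)
  qed
  from riesz_representation[OF lin this] show "\<phi> \<in> range (\<lambda>y x. cinner x y)" by blast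
next
  fix \<phi> :: "'a \<Rightarrow> complex" assume "\<phi> \<in> range (\<lambda>y x. cinner x y)"
  then obtain y where \<phi>: "\<phi> = (\<lambda>x. cinner x y)" by blast
  have "Vector_Spaces.linear scaleC (*) \<phi>"
    by (intro Vector_Spaces.linear.intro) (unfold_locales, auto simp: \<phi> cinner_simps algebra_simps)
  thus "\<phi> \<in> dual_space" using cmod_cinner_le_spin_norm[of _ y] by (auto simp: dual_space_def \<phi>)
qed

lemma cinner_in_dual_space: "(\<lambda>x. cinner x y) \<in> dual_space"
  by (simp add: dual_space_eq)

text \<open>The norming vector of \<open>spin_norm_attained\<close> represents a functional in the
  dual unit ball, so the supremum is a maximum.\<close>

lemma spin_norm_eq_SUP:
  "(SUP \<phi> \<in> {\<phi>\<in>dual_space. dual_norm \<phi> \<le> 1}. cmod (\<phi> x)) = spin_norm (x::'a::spin_factor)"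
proof (rule cSup_eq_maximum)
  obtain y where y: "\<And>z. cmod (cinner z y) \<le> spin_norm z" "cmod (cinner x y) = spin_norm x"
    using spin_norm_attained[of x] by blast
  have "dual_norm (\<lambda>x. cinner x y) \<le> 1"
    unfolding dual_norm_def using order.trans[OF y(1)]
    by (intro cSUP_least) (auto intro: exI[of _ 0])
  thus "spin_norm x \<in> (\<lambda>\<phi>. cmod (\<phi> x)) ` {\<phi> \<in> dual_space. dual_norm \<phi> \<le> 1}"
    using y(2) cinner_in_dual_space[of y] by (intro image_eqI[of _ _ "\<lambda>x. cinner x y"]) auto
next
  fix r assume "r \<in> (\<lambda>\<phi>. cmod (\<phi> x)) ` {\<phi> \<in> dual_space. dual_norm \<phi> \<le> 1}"
  then obtain \<phi> where \<phi>: "\<phi> \<in> dual_space" "dual_norm \<phi> \<le> 1" "r = cmod (\<phi> x)" by auto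
  have "dual_norm \<phi> * spin_norm x \<le> 1 * spin_norm x" using \<phi> by (intro mult_right_mono) auto
  thus "r \<le> spin_norm x" using cmod_le_dual_norm[OF \<phi>(1), of x] \<phi>(3) by simp
qed

text \<open>Reflexivity: a bounded functional on the dual is transported to the Hilbert space, where
  a second use of the Riesz representation yields the evaluation point.\<close>

lemma is_predual_dual_space: "is_predual (dual_space :: ('a::spin_factor \<Rightarrow> complex) set)"
  unfolding is_predual_def
proof (intro conjI allI impI)
  show "closed_subspace_of_dual (dual_space :: ('a \<Rightarrow> complex) set)"
    unfolding closed_subspace_of_dual_def
  proof (intro conjI ballI allI impI)
    show "(\<lambda>_. 0) \<in> (dual_space :: ('a \<Rightarrow> complex) set)"
      using cinner_in_dual_space[of 0] by simp
    show "(\<lambda>x. \<phi> x + \<psi> x) \<in> dual_space" if "\<phi> \<in> dual_space" "\<psi> \<in> dual_space"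
      for \<phi> \<psi> :: "'a \<Rightarrow> complex"
      using that by (auto simp: dual_space_eq cinner_add_right[symmetric])
    show "(\<lambda>x. c * \<phi> x) \<in> dual_space" if "\<phi> \<in> dual_space" for c and \<phi> :: "'a \<Rightarrow> complex"
      using that cinner_in_dual_space[of "cnj c *\<^sub>C _ :: 'a"]
      by (auto simp: dual_space_eq cinner_scaleC_right)
  qed auto
  show "(SUP \<phi> \<in> {\<phi>\<in>dual_space. dual_norm \<phi> \<le> 1}. cmod (\<phi> x)) = spin_norm x" for x :: 'a
    by (rule spin_norm_eq_SUP)
next
  fix F :: "('a \<Rightarrow> complex) \<Rightarrow> complex"
  assume "bounded_functional_on dual_space F"
  then obtain K where
    add: "\<And>\<phi> \<psi>. \<phi> \<in> dual_space \<Longrightarrow> \<psi> \<in> dual_space \<Longrightarrow> F (\<lambda>x. \<phi> x + \<psi> x) = F \<phi> + F \<psi>" and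
    scale: "\<And>\<phi> c. \<phi> \<in> dual_space \<Longrightarrow> F (\<lambda>x. c * \<phi> x) = c * F \<phi>" and
    K: "\<And>\<phi>. \<phi> \<in> dual_space \<Longrightarrow> cmod (F \<phi>) \<le> K * dual_norm \<phi>"
    unfolding bounded_functional_on_def by blast
  \<comment> \<open>The representing vector enters the inner product conjugate-linearly; the outer
    \<open>cnj\<close> restores linearity.\<close>
  define g where "g y = cnj (F (\<lambda>x. cinner x y))" for y
  have "g (y + z) = g y + g z" for y z
    using add[OF cinner_in_dual_space cinner_in_dual_space, of y z]
    by (simp add: g_def cinner_add_right)
  moreover have "g (c *\<^sub>C y) = c * g y" for c y
    using scale[OF cinner_in_dual_space, of "cnj c" y] by (simp add: g_def cinner_scaleC_right)
  ultimately have lin: "Vector_Spaces.linear scaleC (*) g"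
    by (intro Vector_Spaces.linear.intro) (unfold_locales, auto simp: algebra_simps)
  have "cmod (g y) \<le> \<bar>K\<bar> * norm y" for y
  proof -
    \<comment> \<open>\<open>K\<close> may be negative; replacing it by its absolute value requires
      a nonnegative dual norm.\<close>
    have nonneg: "0 \<le> dual_norm (\<lambda>x::'a. cinner x y)"
    proof (cases "y = 0")
      case True
      have "{x::'a. spin_norm x \<le> 1} \<noteq> {}" by (auto intro: exI[of _ 0])
      thus ?thesis by (simp add: dual_norm_def True)
    next
      case False
      have "0 \<le> cmod (cinner y y)" by simp
      also have "\<dots> \<le> dual_norm (\<lambda>x. cinner x y) * spin_norm y"
        by (rule cmod_le_dual_norm[OF cinner_in_dual_space])
      finally show ?thesis
        using False spin_norm_eq_zero[of y] spin_norm_nonneg[of y] by (simp add: zero_le_mult_iff)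
    qed
    have "cmod (g y) \<le> K * dual_norm (\<lambda>x. cinner x y)"
      using K[OF cinner_in_dual_space[of y]] by (simp add: g_def)
    also have "\<dots> \<le> \<bar>K\<bar> * norm y"
      using nonneg dual_norm_cinner_le[of y] by (intro mult_mono) auto
    finally show ?thesis .
  qed
  from riesz_representation[OF lin this] obtain x where x: "g = (\<lambda>y. cinner y x)" .
  have "F (\<lambda>z. cinner z y) = cinner x y" for y
    using fun_cong[OF x, of y] unfolding g_def by (metis cinner_commute complex_cnj_cnj)
  thus "\<exists>x. \<forall>\<phi>\<in>dual_space. F \<phi> = \<phi> x" by (auto simp: dual_space_eq)
qed

text \<open>A proper closed subspace of the Hilbert dual is annihilated by a nonzero vector, whose norm it
  therefore cannot compute; hence reflexivity alone makes the predual unique.\<close>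

lemma is_predual_unique:
  fixes X :: "('a::spin_factor \<Rightarrow> complex) set"
  assumes "is_predual X"
  shows "X = dual_space"
proof (rule ccontr)
  assume ne: "X \<noteq> dual_space"
  have sub: "X \<subseteq> dual_space" and zero: "(\<lambda>_. 0) \<in> X"
    and add: "\<And>\<phi> \<psi>. \<phi> \<in> X \<Longrightarrow> \<psi> \<in> X \<Longrightarrow> (\<lambda>x. \<phi> x + \<psi> x) \<in> X"
    and scale: "\<And>\<phi> c. \<phi> \<in> X \<Longrightarrow> (\<lambda>x. c * \<phi> x) \<in> X"
    and cl: "\<And>\<phi>. \<phi> \<in> dual_space \<Longrightarrow> (\<And>\<epsilon>. \<epsilon> > 0 \<Longrightarrow> \<exists>\<psi>\<in>X. dual_norm (\<lambda>x. \<phi> x - \<psi> x) < \<epsilon>) \<Longrightarrow> \<phi> \<in> X"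
    and sup: "\<And>x. (SUP \<phi> \<in> {\<phi>\<in>X. dual_norm \<phi> \<le> 1}. cmod (\<phi> x)) = spin_norm x"
    using assms unfolding is_predual_def closed_subspace_of_dual_def by blast+
  \<comment> \<open>\<open>Y\<close> is \<open>X\<close> seen inside the Hilbert space through the
    Riesz correspondence.\<close>
  define Y where "Y = {y::'a. (\<lambda>x. cinner x y) \<in> X}"
  have "complex_vector.subspace Y"
    unfolding complex_vector.subspace_def
    using zero add scale by (auto simp: Y_def cinner_add_right cinner_scaleC_right)
  moreover have "closed Y"
    unfolding closed_sequential_limits
  proof (intro allI impI, elim conjE)
    fix s l assume s: "\<forall>n. s n \<in> Y" and l: "s \<longlonglongrightarrow> l"
    have "(\<lambda>x. cinner x l) \<in> X"
    proof (rule cl[OF cinner_in_dual_space])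
      fix \<epsilon> :: real assume "\<epsilon> > 0"
      then obtain n where n: "norm (l - s n) < \<epsilon>"
        using LIMSEQ_D[OF l] by (metis norm_minus_commute order_refl)
      have "dual_norm (\<lambda>x. cinner x l - cinner x (s n)) < \<epsilon>"
        using dual_norm_cinner_le[of "l - s n"] n by (simp add: cinner_diff_right)
      thus "\<exists>\<psi>\<in>X. dual_norm (\<lambda>x. cinner x l - \<psi> x) < \<epsilon>" using s by (auto simp: Y_def)
    qed
    thus "l \<in> Y" by (simp add: Y_def)
  qed
  moreover obtain y where "y \<notin> Y" using sub ne by (auto simp: dual_space_eq Y_def)
  ultimately obtain z where z: "z \<noteq> 0" "\<And>y. y \<in> Y \<Longrightarrow> cinner z y = 0"
    using closed_subspace_orthogonal by blast
  have "\<phi> z = 0" if "\<phi> \<in> X" for \<phi>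
    using that sub z(2) by (auto simp: dual_space_eq Y_def)
  hence "(SUP \<phi> \<in> {\<phi>\<in>X. dual_norm \<phi> \<le> 1}. cmod (\<phi> z))
      = (SUP \<phi> \<in> {\<phi>\<in>X. dual_norm \<phi> \<le> 1}. 0)"
    by (intro SUP_cong) auto
  \<comment> \<open>The supremum of a constant equals that constant only over a nonempty index
    set.\<close>
  moreover have "(\<lambda>_. 0) \<in> {\<phi>\<in>X. dual_norm \<phi> \<le> 1}"
    using zero dual_norm_cinner_le[of "0::'a"] by simp
  hence "{\<phi>\<in>X. dual_norm \<phi> \<le> 1} \<noteq> {}" by blast
  ultimately have "(SUP \<phi> \<in> {\<phi>\<in>X. dual_norm \<phi> \<le> 1}. cmod (\<phi> z)) = 0"
    by (simp only: cSUP_const not_False_eq_True)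
  thus False using sup[of z] z(1) by (simp add: spin_norm_eq_zero)
qed

lemma predual_eq: "predual = range (\<lambda>y (x::'a::spin_factor). cinner x y)"
  unfolding predual_def dual_space_eq[symmetric]
  by (rule the_equality, rule is_predual_dual_space, erule is_predual_unique)

section \<open>Minimal tripotents\<close>

text \<open>A spectral resolution: the eigenvalue is 1 on \<open>e\<close>, 0 on
  \<open>conjugation e\<close>, and 1/2 on the orthogonal complement of both.\<close>

lemma triple_self:
  assumes "unit_null (e::'a::spin_factor)"
  shows "triple e e x = (1/2) *\<^sub>C x + cinner x e *\<^sub>C e - cinner x (conjugation e) *\<^sub>C conjugation e"
  by (simp add: triple_def unit_null_simps[OF assms] cinner_conjugation_right[of e x])

text \<open>The eigenvalue equation is paired with \<open>e\<close> and with
  \<open>conjugation e\<close>. Thus only \<open>k = 2\<close> allows a component along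
  \<open>e\<close>, and only \<open>k = 0\<close> one along \<open>conjugation e\<close>.\<close>

lemma peirce_space_cinner:
  assumes e: "unit_null (e::'a::spin_factor)" and u: "u \<in> peirce_space k e"
  shows "real k * cinner u e = 2 * cinner u e" "real k * cinner u (conjugation e) = 0"
proof -
  note s = unit_null_simps[OF e]
  have eq: "(of_nat k / 2) *\<^sub>C u
      = (1/2) *\<^sub>C u + cinner u e *\<^sub>C e - cinner u (conjugation e) *\<^sub>C conjugation e"
    using u triple_self[OF e, of u] by (simp add: peirce_space_def)
  show "real k * cinner u e = 2 * cinner u e"
    using arg_cong[OF eq, of "\<lambda>v. cinner v e"] by (simp add: cinner_simps s)
  show "real k * cinner u (conjugation e) = 0"
    using arg_cong[OF eq, of "\<lambda>v. cinner v (conjugation e)"] by (simp add: cinner_simps s)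
qed

lemma peirce_space_2:
  assumes e: "unit_null (e::'a::spin_factor)"
  shows "u \<in> peirce_space 2 e \<longleftrightarrow> u = (2 * cinner u e) *\<^sub>C e"
proof
  assume u: "u \<in> peirce_space 2 e"
  have "cinner u (conjugation e) = 0" using peirce_space_cinner(2)[OF e u] by simp
  hence "u = (1/2) *\<^sub>C u + cinner u e *\<^sub>C e"
    using u triple_self[OF e, of u] by (simp add: peirce_space_def)
  hence "2 *\<^sub>C u = 2 *\<^sub>C ((1/2) *\<^sub>C u + cinner u e *\<^sub>C e)" by simp
  also have "\<dots> = u + (2 * cinner u e) *\<^sub>C e" by (simp add: scaleC_add_right scaleC_scaleC)
  also have "2 *\<^sub>C u = u + u" using scaleC_add_left[of 1 1 u] by simp
  finally show "u = (2 * cinner u e) *\<^sub>C e" by simp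
next
  define c where "c = 2 * cinner u e"
  assume "u = (2 * cinner u e) *\<^sub>C e"
  hence u: "u = c *\<^sub>C e" by (simp add: c_def)
  show "u \<in> peirce_space 2 e"
    unfolding peirce_space_def u
    by (simp add: triple_self[OF e] cinner_simps unit_null_simps[OF e] scaleC_scaleC
        flip: scaleC_add_left)
qed

text \<open>The components along \<open>conjugation e\<close>, orthogonal to both, and along
  \<open>e\<close> form a Peirce decomposition. In any other one the parts of index 0 and 1 are
  orthogonal to \<open>e\<close>, which determines the part of index 2.\<close>

lemma peirce_proj_2:
  assumes e: "unit_null (e::'a::spin_factor)"
  shows "peirce_proj 2 e x = (2 * cinner x e) *\<^sub>C e"
  unfolding peirce_proj_def
proof (rule the_equality)
  note s = unit_null_simps[OF e]
  define y where "y = (2 * cinner x e) *\<^sub>C e"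
  define z where "z = (2 * cinner x (conjugation e)) *\<^sub>C conjugation e"
  define u where "u j = (if j = 0 then z else if j = 1 then x - y - z else y)" for j :: nat
  have "y \<in> peirce_space 2 e"
    by (simp add: peirce_space_2[OF e] y_def cinner_simps s)
  moreover have "z \<in> peirce_space 0 e"
    by (simp add: peirce_space_def triple_self[OF e] z_def cinner_simps s scaleC_scaleC)
  moreover have "x - y - z \<in> peirce_space 1 e"
    by (simp add: peirce_space_def triple_self[OF e] y_def z_def cinner_simps s)
  ultimately have "\<forall>j\<le>2. u j \<in> peirce_space j e"
    by (auto simp: u_def le_Suc_eq numeral_2_eq_2)
  moreover have "x = (\<Sum>j\<le>2. u j)" by (simp add: u_def numeral_2_eq_2)
  ultimately show "\<exists>u. (\<forall>j\<le>2. u j \<in> peirce_space j e) \<and> x = (\<Sum>j\<le>2. u j)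
      \<and> (2 * cinner x e) *\<^sub>C e = u 2"
    by (intro exI[of _ u]) (simp add: u_def y_def)
next
  fix y assume "\<exists>u. (\<forall>j\<le>2. u j \<in> peirce_space j e) \<and> x = (\<Sum>j\<le>2. u j) \<and> y = u 2"
  then obtain u where u: "\<And>j. j \<le> 2 \<Longrightarrow> u j \<in> peirce_space j e" and x: "x = (\<Sum>j\<le>2. u j)"
    and y: "y = u 2" by blast
  have "cinner (u 0) e = 0" "cinner (u 1) e = 0"
    using peirce_space_cinner(1)[OF e u, of 0] peirce_space_cinner(1)[OF e u, of 1] by simp_all
  hence "cinner x e = cinner (u 2) e" by (simp add: x numeral_2_eq_2 cinner_simps)
  thus "y = (2 * cinner x e) *\<^sub>C e" using u[of 2] peirce_space_2[OF e] y by simp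
qed

lemma exists_not_multiple:
  obtains z where "\<And>c. (z::'a::spin_factor) \<noteq> c *\<^sub>C x"
proof -
  obtain p q r :: 'a where
    ind: "\<And>a b c. a *\<^sub>C p + b *\<^sub>C q + c *\<^sub>C r = 0 \<Longrightarrow> a = 0 \<and> b = 0 \<and> c = 0"
    using dim_ge_3 by blast
  have "\<exists>z. \<forall>c. z \<noteq> c *\<^sub>C x"
  proof (rule ccontr)
    assume "\<nexists>z. \<forall>c. z \<noteq> c *\<^sub>C x"
    then obtain \<alpha> \<beta> where pq: "p = \<alpha> *\<^sub>C x" "q = \<beta> *\<^sub>C x" by metis
    \<comment> \<open>Two multiples of one vector satisfy this relation; independence makes both
      scalars zero, hence \<open>p\<close> too.\<close>
    have "\<beta> *\<^sub>C p + (- \<alpha>) *\<^sub>C q + 0 *\<^sub>C r = 0"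
      by (simp add: pq scaleC_scaleC mult.commute)
    hence "p = 0" using ind[of \<beta> "- \<alpha>" 0] pq by simp
    thus False using ind[of 1 0 0] by simp
  qed
  thus ?thesis using that by blast
qed

text \<open>The tripotent equation makes \<open>(2 * a - 1)\<close> times \<open>e\<close> equal to
  \<open>b\<close> times \<open>conjugation e\<close>. If \<open>b = 0\<close>, then
  \<open>a = 1/2\<close>. Otherwise \<open>conjugation e\<close> is a unimodular multiple of
  \<open>e\<close> and the Peirce-2 space is everything, which is too large for minimality.\<close>

lemma minimal_tripotents_iff: "e \<in> minimal_tripotents \<longleftrightarrow> unit_null (e::'a::spin_factor)"
proof
  assume e: "unit_null e"
  note s = unit_null_simps[OF e]
  have "tripotent e"
    by (simp add: tripotent_def triple_self[OF e] s flip: scaleC_add_left)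
  moreover have "peirce_space 2 e = range (\<lambda>c. c *\<^sub>C e)"
    by (auto simp: peirce_space_2[OF e] cinner_simps s)
  moreover have "e \<in> peirce_space 2 e" by (simp add: peirce_space_2[OF e] s)
  moreover have "e \<noteq> 0" using s by auto
  ultimately show "e \<in> minimal_tripotents" unfolding minimal_tripotents_def by auto
next
  assume "e \<in> minimal_tripotents"
  hence trip: "triple e e e = e" and P2: "peirce_space 2 e = range (\<lambda>c. c *\<^sub>C e)"
    and ne: "peirce_space 2 e \<noteq> {0}"
    by (auto simp: minimal_tripotents_def tripotent_def)
  have e0: "e \<noteq> 0" using P2 ne by auto
  define a b where "a = cinner e e" and "b = cinner e (conjugation e)"
  have a0: "a \<noteq> 0" using e0 by (simp add: a_def cinner_self)
  have "(2 * a) *\<^sub>C e - b *\<^sub>C conjugation e = e"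
    using trip by (simp add: triple_def a_def b_def flip: scaleC_add_left)
  hence eq: "(2 * a - 1) *\<^sub>C e = b *\<^sub>C conjugation e"
    by (simp add: complex_vector.scale_left_diff_distrib diff_eq_eq eq_diff_eq add.commute)
  show "unit_null e"
  proof (cases "b = 0")
    case True
    hence "2 * a = 1" using eq e0 by simp
    hence "a = 1/2" by (simp add: eq_divide_eq mult.commute)
    thus ?thesis using True by (simp add: unit_null_def a_def b_def)
  next
    case False
    define m where "m = (2 * a - 1) / b"
    have "conjugation e = (1 / b) *\<^sub>C (b *\<^sub>C conjugation e)"
      using False by (simp add: scaleC_scaleC)
    also have "\<dots> = m *\<^sub>C e" by (simp add: eq[symmetric] scaleC_scaleC m_def)
    finally have m: "conjugation e = m *\<^sub>C e" .
    have "cmod m * norm e = norm e"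
      by (metis m norm_conjugation norm_scaleC)
    hence "cmod m = 1" using e0 by simp
    hence mm: "m * cnj m = 1" by (simp add: complex_norm_square[symmetric])
    have "b = cnj m * a" by (simp add: b_def a_def m cinner_simps)
    hence "b * m = a" using mm by (simp add: algebra_simps)
    \<comment> \<open>By definition of \<open>m\<close>, \<open>b * m\<close> is
      \<open>2 * a - 1\<close>, while it has just been shown to be \<open>a\<close>.\<close>
    hence a1: "a = 1" using False by (simp add: m_def)
    have "triple e e x = x" for x
    proof -
      have "cinner e (conjugation x) = cnj m * cinner x e"
        using cinner_conjugation_right[of e x] by (simp add: m cinner_simps)
      hence "triple e e x = x + cinner x e *\<^sub>C e - (cnj m * cinner x e * m) *\<^sub>C e"
        using a1 by (simp add: triple_def a_def m scaleC_scaleC)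
      moreover have "cnj m * cinner x e * m = cinner x e"
        using mm by (simp add: algebra_simps)
      ultimately show ?thesis by simp
    qed
    hence "x \<in> range (\<lambda>c. c *\<^sub>C e)" for x
      using P2 by (auto simp: peirce_space_def)
    moreover obtain z where "\<And>c. z \<noteq> c *\<^sub>C e"
      using exists_not_multiple by blast
    hence "z \<notin> range (\<lambda>c. c *\<^sub>C e)" by auto
    ultimately show ?thesis by blast
  qed
qed

text \<open>The unit ball of the predual lies in the Hilbert ball of radius \<open>sqrt 2\<close>, on whose boundary the
  functional of a minimal tripotent sits. Strict convexity of the Hilbert norm gives extremality.\<close>

lemma norm_le_of_dual_norm_le:
  assumes "dual_norm (\<lambda>x. cinner x y) \<le> 1"
  shows "(norm (y::'a::spin_factor))\<^sup>2 \<le> 2"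
proof (cases "y = 0")
  case False
  have "(norm y)\<^sup>2 = cmod (cinner y y)" by (simp add: cinner_self norm_power)
  also have "\<dots> \<le> dual_norm (\<lambda>x. cinner x y) * spin_norm y"
    by (rule cmod_le_dual_norm[OF cinner_in_dual_space])
  also have "\<dots> \<le> 1 * spin_norm y" using assms by (intro mult_right_mono) auto
  finally have "((norm y)\<^sup>2)\<^sup>2 \<le> (spin_norm y)\<^sup>2" by (intro power_mono) auto
  also have "\<dots> \<le> 2 * (norm y)\<^sup>2" by (rule spin_norm_le)
  finally have "(norm y)\<^sup>2 * (norm y)\<^sup>2 \<le> 2 * (norm y)\<^sup>2"
    by (simp only: power2_eq_square[of "(norm y)\<^sup>2"])
  thus ?thesis by (rule mult_right_le_imp_le) (use False in simp)
qed simp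

lemma extreme_functional_unit_null:
  assumes e: "unit_null (e::'a::spin_factor)"
  shows "extreme_functional (\<lambda>x. 2 * cinner x e) predual_ball"
  unfolding extreme_functional_def
proof (intro conjI ballI allI impI)
  have "dual_norm (\<lambda>x. 2 * cinner x e) \<le> 1"
    unfolding dual_norm_def using order.trans[OF cmod_cinner_unit_null_le[OF e]]
    by (intro cSUP_least) (auto simp: norm_mult intro: exI[of _ 0])
  moreover have "(\<lambda>x. 2 * cinner x e) = (\<lambda>x. cinner x (2 *\<^sub>C e))"
    by (simp add: cinner_simps)
  ultimately show "(\<lambda>x. 2 * cinner x e) \<in> predual_ball"
    by (auto simp: predual_ball_def predual_eq)
next
  fix \<psi> \<theta> :: "'a \<Rightarrow> complex" and t :: real
  assume \<psi>: "\<psi> \<in> predual_ball" and \<theta>: "\<theta> \<in> predual_ball"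
    and *: "0 < t \<and> t < 1 \<and> (\<lambda>x. 2 * cinner x e) = (\<lambda>x. of_real (1 - t) * \<psi> x + of_real t * \<theta> x)"
  obtain y where y: "\<psi> = (\<lambda>x. cinner x y)" "(norm y)\<^sup>2 \<le> 2"
    using \<psi> norm_le_of_dual_norm_le by (auto simp: predual_ball_def predual_eq)
  obtain z where z: "\<theta> = (\<lambda>x. cinner x z)" "(norm z)\<^sup>2 \<le> 2"
    using \<theta> norm_le_of_dual_norm_le by (auto simp: predual_ball_def predual_eq)
  have "cinner x (2 *\<^sub>R e) = cinner x ((1 - t) *\<^sub>R y + t *\<^sub>R z)" for x
    using fun_cong[of _ _ x, OF conjunct2[OF conjunct2[OF *]]]
    by (simp add: y z scaleR_eq_scaleC cinner_simps)
  hence "2 *\<^sub>R e = (1 - t) *\<^sub>R y + t *\<^sub>R z" by (rule cinner_eqI_right)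
  hence "(norm (2 *\<^sub>R e))\<^sup>2 = (norm ((1 - t) *\<^sub>R y + t *\<^sub>R z))\<^sup>2" by simp
  \<comment> \<open>Strict convexity in quantitative form: since the left side already has the
    maximal value 2, the defect term with \<open>norm (y - z)\<close> must vanish.\<close>
  moreover have "(norm ((1 - t) *\<^sub>R y + t *\<^sub>R z))\<^sup>2
      = (1 - t) * (norm y)\<^sup>2 + t * (norm z)\<^sup>2 - t * (1 - t) * (norm (y - z))\<^sup>2"
    unfolding power2_norm_eq_inner by (simp add: inner_simps inner_commute algebra_simps)
  moreover have "(norm (2 *\<^sub>R e))\<^sup>2 = 2" by (simp add: power_mult_distrib unit_null_norm[OF e])
  moreover have "(1 - t) * (norm y)\<^sup>2 + t * (norm z)\<^sup>2 \<le> (1 - t) * 2 + t * 2"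
    using * y z by (intro add_mono mult_left_mono) auto
  ultimately have "t * (1 - t) * (norm (y - z))\<^sup>2 \<le> 0" by simp
  moreover have "t * (1 - t) > 0" using * by simp
  ultimately have "(norm (y - z))\<^sup>2 \<le> 0"
    using mult_le_cancel_left_pos[of "t * (1 - t)" "(norm (y - z))\<^sup>2" 0]
    by (simp only: mult_zero_right)
  thus "\<psi> = \<theta>" by (simp add: y z)
qed

lemma support_functional_eq:
  assumes e: "unit_null (e::'a::spin_factor)"
  shows "support_functional e = (\<lambda>x. 2 * cinner x e)"
  unfolding support_functional_def
proof (rule the_equality)
  show "extreme_functional (\<lambda>x. 2 * cinner x e) predual_ball
    \<and> (\<forall>x. peirce_proj 2 e x = (2 * cinner x e) *\<^sub>C e)"
    using extreme_functional_unit_null[OF e] peirce_proj_2[OF e] by simp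
next
  fix \<phi> assume "extreme_functional \<phi> predual_ball \<and> (\<forall>x. peirce_proj 2 e x = \<phi> x *\<^sub>C e)"
  moreover have "e \<noteq> 0" using unit_null_simps(1)[OF e] by auto
  ultimately show "\<phi> = (\<lambda>x. 2 * cinner x e)" using peirce_proj_2[OF e] by auto
qed

section \<open>Self-conjugate vectors and the span of the minimal tripotents\<close>

text \<open>A Gram-Schmidt step on a vector that is no multiple of \<open>x\<close>, followed by
  taking a real part; both keep orthogonality to \<open>x\<close>.\<close>

lemma exists_selfconjugate_orthogonal:
  fixes x :: "'a::spin_factor"
  assumes x: "conjugation x = x"
  obtains y where "conjugation y = y" "norm y = 1" "cinner y x = 0"
proof -
  obtain z where z: "\<And>c. z \<noteq> c *\<^sub>C x" using exists_not_multiple by blast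
  define w where "w = z - (cinner z x / cinner x x) *\<^sub>C x"
  have w0: "w \<noteq> 0" using z[of "cinner z x / cinner x x"] by (simp add: w_def)
  have wx: "cinner w x = 0"
    by (cases "x = 0") (simp_all add: w_def cinner_simps cinner_self)
  have wx': "cinner (conjugation w) x = 0"
    using wx cinner_conjugation_left[of w x] x by (metis cinner_commute complex_cnj_zero)
  \<comment> \<open>If the real part vanishes, \<open>w\<close> is purely imaginary, and \<i> times
    \<open>w\<close> is self-conjugate and nonzero.\<close>
  define v where "v = (if w + conjugation w = 0 then \<i> *\<^sub>C w else w + conjugation w)"
  have "conjugation w = - w" if "w + conjugation w = 0"
    using that by (simp add: eq_neg_iff_add_eq_0 add.commute)
  hence v: "conjugation v = v" "cinner v x = 0" "v \<noteq> 0"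
    using w0 wx wx' by (auto simp: v_def conjugation_simps cinner_simps add.commute)
  show ?thesis
  proof (rule that[of "complex_of_real (1 / norm v) *\<^sub>C v"])
    show "norm (complex_of_real (1 / norm v) *\<^sub>C v) = 1"
      using v by (simp add: norm_scaleC norm_divide)
  qed (use v in \<open>simp_all add: conjugation_simps cinner_simps\<close>)
qed

text \<open>An orthonormal pair of self-conjugate vectors yields a minimal tripotent: in the
  bilinear form the square of \<i> cancels the two unit lengths.\<close>

lemma unit_null_of_selfconjugate:
  fixes x y :: "'a::spin_factor"
  assumes "conjugation x = x" "norm x = 1" "conjugation y = y" "norm y = 1" "cinner y x = 0"
  shows "unit_null ((1/2) *\<^sub>C (x + \<i> *\<^sub>C y))"
proof -
  have "cinner x y = 0" using assms(5) by (metis cinner_commute complex_cnj_zero)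
  moreover have "cinner x x = 1" "cinner y y = 1" using assms by (simp_all add: cinner_self)
  ultimately show ?thesis
    using assms by (simp add: unit_null_def conjugation_simps cinner_simps)
qed

lemma selfconjugate_decomposition:
  fixes x :: "'a::spin_factor"
  obtains u v where "conjugation u = u" "conjugation v = v" "x = u + \<i> *\<^sub>C v"
proof (rule that)
  show "conjugation ((1/2) *\<^sub>C (x + conjugation x)) = (1/2) *\<^sub>C (x + conjugation x)"
    by (simp add: conjugation_simps add.commute)
  show "conjugation ((- \<i>/2) *\<^sub>C (x - conjugation x)) = (- \<i>/2) *\<^sub>C (x - conjugation x)"
    by (simp add: conjugation_simps complex_vector.scale_right_diff_distrib)
  have "(1/2) *\<^sub>C (x + conjugation x) + \<i> *\<^sub>C ((- \<i>/2) *\<^sub>C (x - conjugation x))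
      = (1/2) *\<^sub>C x + (1/2) *\<^sub>C x"
    by (simp add: scaleC_scaleC scaleC_add_right complex_vector.scale_right_diff_distrib)
  also have "\<dots> = x" by (simp flip: scaleC_add_left)
  finally show "x = (1/2) *\<^sub>C (x + conjugation x) + \<i> *\<^sub>C ((- \<i>/2) *\<^sub>C (x - conjugation x))" ..
qed

text \<open>A self-conjugate unit vector \<open>x'\<close> is the sum of the minimal tripotents
  built from \<open>x'\<close> with \<open>y\<close> and with \<open>- y\<close>. Finite
  combinations therefore reach every vector through its real and imaginary parts.\<close>

lemma span_unit_null: "complex_vector.span (Collect unit_null) = (UNIV :: 'a::spin_factor set)"
proof -
  let ?S = "complex_vector.span (Collect unit_null) :: 'a set"
  have sc: "x \<in> ?S" if x: "conjugation x = x" for x :: 'a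
  proof (cases "x = 0")
    case False
    define x' where "x' = complex_of_real (1 / norm x) *\<^sub>C x"
    have x': "conjugation x' = x'" "norm x' = 1"
      using x False by (simp_all add: x'_def conjugation_simps norm_scaleC norm_divide)
    obtain y where y: "conjugation y = y" "norm y = 1" "cinner y x' = 0"
      using exists_selfconjugate_orthogonal[OF x'(1)] .
    define e f where "e = (1/2) *\<^sub>C (x' + \<i> *\<^sub>C y)" and "f = (1/2) *\<^sub>C (x' + \<i> *\<^sub>C (- y))"
    have "unit_null e" "unit_null f"
      using unit_null_of_selfconjugate[of x' y] unit_null_of_selfconjugate[of x' "- y"] x' y
      by (simp_all add: e_def f_def conjugation_minus cinner_minus_left)
    hence "e + f \<in> ?S"
      by (intro complex_vector.span_add complex_vector.span_base) auto
    hence "complex_of_real (norm x) *\<^sub>C (e + f) \<in> ?S" by (rule complex_vector.span_scale)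
    moreover have "e + f = (1/2) *\<^sub>C x' + (1/2) *\<^sub>C x'"
      by (simp add: e_def f_def scaleC_add_right complex_vector.scale_right_diff_distrib)
    hence "e + f = x'" by (simp flip: scaleC_add_left)
    ultimately show ?thesis using False by (simp add: x'_def scaleC_scaleC)
  qed (simp add: complex_vector.span_zero)
  have "x \<in> ?S" for x
  proof -
    obtain u v where "conjugation u = u" "conjugation v = v" "x = u + \<i> *\<^sub>C v"
      using selfconjugate_decomposition .
    thus ?thesis using sc by (simp add: complex_vector.span_add complex_vector.span_scale)
  qed
  thus ?thesis by blast
qed

section \<open>Extension to a triple isomorphism\<close>

lemma cinner_selfconjugate:
  assumes "conjugation x = x" "conjugation y = (y::'a::spin_factor)"
  shows "cinner x y = complex_of_real (inner x y)"
proof (rule complex_eqI)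
  have "cinner x y = cinner y x" using cinner_conjugation[of x y] assms by simp
  hence "cinner x y = cnj (cinner x y)" by (metis cinner_commute)
  thus "Im (cinner x y) = Im (complex_of_real (inner x y))"
    by (auto dest: arg_cong[of _ _ Im])
qed (simp add: inner_eq_Re_cinner)

text \<open>The symmetric bilinear forms \<open>cinner x (conjugation y)\<close> on both sides have the same null cone
  under \<open>T\<close>, hence are proportional. The factor need not be 1, but it is unimodular and
  cancels in the triple product, where the conjugation occurs twice.\<close>

lemma unit_null_preserving_proportional:
  fixes T :: "'m::spin_factor \<Rightarrow> 'n::spin_factor"
  assumes lin: "Vector_Spaces.linear scaleC scaleC T"
    and null: "\<And>e. unit_null e \<Longrightarrow> unit_null (T e)"
  obtains c where "\<And>x y. cinner (T x) (conjugation (T y)) = c * cinner x (conjugation y)"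
proof -
  interpret T: Vector_Spaces.linear scaleC scaleC T by fact
  define B where "B x y = cinner (T x) (conjugation (T y))" for x y
  have B_add: "B (x + y) z = B x z + B y z" "B z (x + y) = B z x + B z y"
    and B_scale: "B (a *\<^sub>C x) y = a * B x y" "B y (a *\<^sub>C x) = a * B y x"
    for x y z and a :: complex
    by (simp_all add: B_def T.add T.scale conjugation_simps cinner_simps)
  have B_sym: "B x y = B y x" for x y by (simp add: B_def cinner_conjugation_right)
  have unit: "B x y = 0 \<and> B x x = B y y"
    if "conjugation x = x" "norm x = 1" "conjugation y = y" "norm y = 1" "cinner y x = 0" for x y
  proof -
    \<comment> \<open>The vector built from \<open>x\<close> and \<open>s\<close> times
      \<open>y\<close> is null for both signs; comparing signs isolates \<open>B x y\<close> and
      \<open>B x x - B y y\<close>.\<close>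
    have *: "B x x + 2 * \<i> * s * B x y - s * s * B y y = 0" if s: "s = 1 \<or> s = -1" for s :: complex
    proof -
      have "unit_null ((1/2) *\<^sub>C (x + \<i> *\<^sub>C (s *\<^sub>C y)))"
        using \<open>conjugation x = x\<close> \<open>norm x = 1\<close> \<open>conjugation y = y\<close> \<open>norm y = 1\<close> \<open>cinner y x = 0\<close> s
        by (intro unit_null_of_selfconjugate)
          (auto simp: conjugation_simps norm_scaleC cinner_simps)
      from null[OF this] have "B ((1/2) *\<^sub>C (x + \<i> *\<^sub>C (s *\<^sub>C y))) ((1/2) *\<^sub>C (x + \<i> *\<^sub>C (s *\<^sub>C y))) = 0"
        by (simp add: B_def unit_null_def)
      thus ?thesis by (simp add: B_add B_scale B_sym[of y x] algebra_simps)
    qed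
    from *[of 1] *[of "-1"] have "B x x - B y y = - (2 * \<i> * B x y)" "B x x - B y y = 2 * \<i> * B x y"
      by (simp_all add: algebra_simps eq_neg_iff_add_eq_0)
    thus ?thesis by simp
  qed
  \<comment> \<open>Orthogonality to 0 is vacuous, so this supplies a reference unit vector from
    which \<open>c\<close> is read off.\<close>
  obtain u :: 'm where u: "conjugation u = u" "norm u = 1"
    using exists_selfconjugate_orthogonal[of 0] by auto
  define c where "c = B u u"
  have orth: "B u v = 0 \<and> B v v = c * complex_of_real ((norm v)\<^sup>2)"
    if v: "conjugation v = v" "cinner v u = 0" for v
  proof (cases "v = 0")
    case True
    thus ?thesis using B_scale(1)[of 0 0] B_scale(2)[of _ 0 0] by simp
  next
    case False
    define w where "w = complex_of_real (1 / norm v) *\<^sub>C v"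
    have "B u w = 0 \<and> B u u = B w w"
      using u v False
      by (intro unit) (simp_all add: w_def conjugation_simps norm_scaleC norm_divide cinner_simps)
    moreover define r where "r = complex_of_real (norm v)"
    have v_eq: "v = r *\<^sub>C w"
      using False by (simp add: w_def r_def scaleC_scaleC)
    have "B u v = r * B u w" "B v v = r * r * B w w"
      unfolding v_eq by (simp_all add: B_scale)
    ultimately show ?thesis by (simp add: c_def r_def power2_eq_square)
  qed
  \<comment> \<open>The part of \<open>x\<close> orthogonal to \<open>u\<close> is handled by
    \<open>orth\<close>, which also removes the mixed terms.\<close>
  have diag: "B x x = c * complex_of_real ((norm x)\<^sup>2)" if x: "conjugation x = x" for x
  proof -
    define a where "a = inner x u"
    define v where "v = x - complex_of_real a *\<^sub>C u"
    have uu: "cinner u u = 1" using u by (simp add: cinner_self)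
    have v: "conjugation v = v" "cinner v u = 0"
      using u x uu by (simp_all add: v_def conjugation_simps cinner_simps cinner_selfconjugate[OF x u(1)] a_def)
    have uv: "cinner u v = 0" using v(2) by (metis cinner_commute complex_cnj_zero)
    have xv: "x = complex_of_real a *\<^sub>C u + v" by (simp add: v_def)
    have "complex_of_real ((norm x)\<^sup>2) = a * a + complex_of_real ((norm v)\<^sup>2)"
      unfolding cinner_self[symmetric] by (subst (1 2) xv) (simp add: cinner_simps uu v uv)
    moreover have "B x x = a * a * c + B v v"
      using orth[OF v] by (subst (1 2) xv) (simp add: B_add B_scale B_sym[of v u] c_def)
    ultimately show ?thesis using orth[OF v] by (simp add: algebra_simps)
  qed
  \<comment> \<open>Polarisation of \<open>diag\<close> on the real space of self-conjugate
    vectors.\<close>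
  have sc: "B x y = c * cinner x y" if x: "conjugation x = x" and y: "conjugation y = y" for x y
  proof -
    have "conjugation (x + y) = x + y" using x y by (simp add: conjugation_add)
    from diag[OF this] have "B x x + B y y + 2 * B x y = c * complex_of_real ((norm (x + y))\<^sup>2)"
      by (simp add: B_add B_sym[of y x] algebra_simps)
    moreover have "(norm (x + y))\<^sup>2 = (norm x)\<^sup>2 + (norm y)\<^sup>2 + 2 * inner x y"
      by (simp add: power2_norm_eq_inner inner_simps inner_commute)
    ultimately have "2 * B x y = 2 * (c * cinner x y)"
      by (simp add: diag[OF x] diag[OF y] cinner_selfconjugate[OF x y] algebra_simps)
    thus ?thesis by simp
  qed
  have "B x y = c * cinner x (conjugation y)" for x y
  proof -
    obtain p q where p: "conjugation p = p" and q: "conjugation q = q" and x: "x = p + \<i> *\<^sub>C q"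
      using selfconjugate_decomposition .
    obtain r s where r: "conjugation r = r" and s: "conjugation s = s" and y: "y = r + \<i> *\<^sub>C s"
      using selfconjugate_decomposition .
    show ?thesis
      by (simp add: x y B_add B_scale sc p q r s conjugation_simps cinner_simps algebra_simps)
  qed
  thus ?thesis unfolding B_def by (rule that)
qed

text \<open>Proportionality of the bilinear forms makes \<open>T\<close> commute with the
  conjugations up to the factor \<open>cnj c\<close>. Isometry forces \<open>c * cnj c = 1\<close>,
  which is the factor arising in the last term of the triple product.\<close>

lemma triple_isomorphismI:
  fixes T :: "'m::spin_factor \<Rightarrow> 'n::spin_factor"
  assumes lin: "Vector_Spaces.linear scaleC scaleC T" and surj: "surj T"
    and iso: "\<And>x y. cinner (T x) (T y) = cinner x y"
    and null: "\<And>e. unit_null e \<Longrightarrow> unit_null (T e)"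
  shows "triple_isomorphism T"
proof -
  interpret T: Vector_Spaces.linear scaleC scaleC T by fact
  obtain c where c: "\<And>x y. cinner (T x) (conjugation (T y)) = c * cinner x (conjugation y)"
    using unit_null_preserving_proportional[OF lin null] by blast
  have inj: "inj T" by (rule injI) (metis cinner_eqI iso)
  have conj: "conjugation (T y) = cnj c *\<^sub>C T (conjugation y)" for y
  proof (rule cinner_eqI_right)
    fix z
    obtain x where "z = T x" using surj by blast
    thus "cinner z (conjugation (T y)) = cinner z (cnj c *\<^sub>C T (conjugation y))"
      by (simp add: c iso cinner_simps)
  qed
  obtain u :: 'm where u: "norm u = 1" using exists_selfconjugate_orthogonal[of 0] by auto
  have "cinner (conjugation (T u)) (conjugation (T u)) = cnj c * c * cinner u u"
    unfolding conj by (simp add: cinner_simps iso cinner_conjugation)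
  moreover have "cinner (conjugation (T u)) (conjugation (T u)) = cinner u u"
    by (simp only: cinner_conjugation iso)
  ultimately have c1: "c * cnj c = 1" using u by (simp add: cinner_self mult.commute)
  have "T (triple x y z) = triple (T x) (T y) (T z)" for x y z
    by (simp add: triple_def T.add T.diff T.scale iso c conj[of y] scaleC_scaleC c1)
  thus ?thesis using lin inj surj by (simp add: triple_isomorphism_def bij_def)
qed

text \<open>Linear maps agreeing on a spanning set coincide.\<close>

lemma triple_isomorphism_unique:
  fixes S T :: "'m::spin_factor \<Rightarrow> 'n::spin_factor"
  assumes "triple_isomorphism S" "triple_isomorphism T"
    and "\<And>e. unit_null e \<Longrightarrow> S e = T e"
  shows "S = T"
proof
  fix x
  interpret vector_space_pair "scaleC :: complex \<Rightarrow> 'm \<Rightarrow> 'm" "scaleC :: complex \<Rightarrow> 'n \<Rightarrow> 'n" ..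
  show "S x = T x"
    using assms span_unit_null
    by (intro linear_eq_on[of S T x "Collect unit_null"]) (auto simp: triple_isomorphism_def)
qed

theorem theorem3p2:
  fixes \<Phi> :: "'m::spin_factor \<Rightarrow> 'n::spin_factor"
  assumes "bij_betw \<Phi> minimal_tripotents minimal_tripotents"
    and "\<forall>e\<in>minimal_tripotents. \<forall>v\<in>minimal_tripotents. TTP (\<Phi> v) (\<Phi> e) = TTP v e"
  shows "\<exists>!T :: 'm \<Rightarrow> 'n. triple_isomorphism T \<and> (\<forall>e\<in>minimal_tripotents. T e = \<Phi> e)"
proof -
  have \<Phi>: "unit_null (\<Phi> e)" if "unit_null e" for e
    using assms(1) that bij_betwE by (fastforce simp: minimal_tripotents_iff)
  have \<Phi>_surj: "\<exists>e. unit_null e \<and> v = \<Phi> e" if "unit_null v" for v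
    using bij_betw_imp_surj_on[OF assms(1)] that minimal_tripotents_iff by (metis imageE)
  have \<Phi>_cinner: "cinner (\<Phi> v) (\<Phi> e) = cinner v e" if "unit_null e" "unit_null v" for e v
    using assms(2) that \<Phi> by (simp add: minimal_tripotents_iff TTP_def support_functional_eq)
  \<comment> \<open>The vectors \<open>\<Phi> e\<close> are all the minimal tripotents of the
    target, and these span it.\<close>
  have uniq: "y = z" if "\<And>e. unit_null e \<Longrightarrow> cinner y (\<Phi> e) = cinner z (\<Phi> e)" for y z
  proof (rule cinner_eqI)
    fix w :: 'n
    have "complex_vector.subspace {w. cinner y w = cinner z w}"
      by (auto simp: complex_vector.subspace_def cinner_simps)
    moreover have "w \<in> complex_vector.span (Collect unit_null)" by (simp add: span_unit_null)
    ultimately show "cinner y w = cinner z w"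
      using complex_vector.span_induct[of w "Collect unit_null" "\<lambda>w. cinner y w = cinner z w"]
        that \<Phi>_surj by blast
  qed
  \<comment> \<open>\<open>T x\<close> is specified by its inner products with all
    \<open>\<Phi> e\<close>. Such a vector exists for minimal tripotents and for linear
    combinations; by \<open>uniq\<close> it is unique, so no choice of representation of
    \<open>x\<close> enters and linearity follows.\<close>
  have "\<exists>y. \<forall>e. unit_null e \<longrightarrow> cinner y (\<Phi> e) = cinner x e" for x
  proof (rule complex_vector.span_induct[of x "Collect unit_null"
        "\<lambda>x. \<exists>y. \<forall>e. unit_null e \<longrightarrow> cinner y (\<Phi> e) = cinner x e"])
    show "x \<in> complex_vector.span (Collect unit_null)" by (simp add: span_unit_null)
    show "complex_vector.subspace {x. \<exists>y. \<forall>e. unit_null e \<longrightarrow> cinner y (\<Phi> e) = cinner x e}"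
      unfolding complex_vector.subspace_def mem_Collect_eq
    proof (intro conjI allI ballI impI)
      show "\<exists>y. \<forall>e. unit_null e \<longrightarrow> cinner y (\<Phi> e) = cinner 0 e" by (intro exI[of _ 0]) simp
    next
      fix a b
      assume "a \<in> {x. \<exists>y. \<forall>e. unit_null e \<longrightarrow> cinner y (\<Phi> e) = cinner x e}"
        and "b \<in> {x. \<exists>y. \<forall>e. unit_null e \<longrightarrow> cinner y (\<Phi> e) = cinner x e}"
      then obtain y z where "\<forall>e. unit_null e \<longrightarrow> cinner y (\<Phi> e) = cinner a e"
        "\<forall>e. unit_null e \<longrightarrow> cinner z (\<Phi> e) = cinner b e" by blast
      thus "\<exists>y. \<forall>e. unit_null e \<longrightarrow> cinner y (\<Phi> e) = cinner (a + b) e"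
        by (intro exI[of _ "y + z"]) (simp add: cinner_simps)
    next
      fix k a
      assume "a \<in> {x. \<exists>y. \<forall>e. unit_null e \<longrightarrow> cinner y (\<Phi> e) = cinner x e}"
      then obtain y where "\<forall>e. unit_null e \<longrightarrow> cinner y (\<Phi> e) = cinner a e" by blast
      thus "\<exists>y. \<forall>e. unit_null e \<longrightarrow> cinner y (\<Phi> e) = cinner (k *\<^sub>C a) e"
        by (intro exI[of _ "k *\<^sub>C y"]) (simp add: cinner_simps)
    qed
  qed (use \<Phi>_cinner in blast)
  then obtain T where T: "\<And>x e. unit_null e \<Longrightarrow> cinner (T x) (\<Phi> e) = cinner x e" by metis
  have T_unit_null: "T e = \<Phi> e" if "unit_null e" for e
    using that by (intro uniq) (simp add: T \<Phi>_cinner)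
  have lin: "Vector_Spaces.linear scaleC scaleC T"
    by (intro Vector_Spaces.linear.intro) (unfold_locales, auto intro!: uniq simp: T cinner_simps)
  interpret T: Vector_Spaces.linear scaleC scaleC T by fact
  \<comment> \<open>Linearity in \<open>y\<close> reduces this to minimal tripotents, where it is
    the specification of \<open>T\<close>.\<close>
  have iso: "cinner (T x) (T y) = cinner x y" for x y
  proof (rule complex_vector.span_induct[of y "Collect unit_null"])
    show "y \<in> complex_vector.span (Collect unit_null)" by (simp add: span_unit_null)
    show "complex_vector.subspace {y. cinner (T x) (T y) = cinner x y}"
      by (auto simp: complex_vector.subspace_def T.zero T.add T.scale cinner_simps)
  qed (simp add: T T_unit_null)
  \<comment> \<open>The range is a subspace containing every minimal tripotent of the
    target.\<close>
  have "y \<in> range T" for y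
  proof (rule complex_vector.span_induct[of y "Collect unit_null"])
    show "y \<in> complex_vector.span (Collect unit_null)" by (simp add: span_unit_null)
    show "complex_vector.subspace {y. y \<in> range T}"
      using complex_vector.subspace_UNIV T.subspace_image by auto
    show "v \<in> range T" if "v \<in> Collect unit_null" for v
      using that \<Phi>_surj T_unit_null by (metis mem_Collect_eq rangeI)
  qed
  hence triple: "triple_isomorphism T"
    using \<Phi> by (intro triple_isomorphismI lin iso) (auto simp: T_unit_null)
  show ?thesis
  proof (rule ex1I)
    show "triple_isomorphism T \<and> (\<forall>e\<in>minimal_tripotents. T e = \<Phi> e)"
      using triple T_unit_null by (simp add: minimal_tripotents_iff)
    show "S = T" if "triple_isomorphism S \<and> (\<forall>e\<in>minimal_tripotents. S e = \<Phi> e)" for S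
      using that T_unit_null
      by (intro triple_isomorphism_unique[OF _ triple]) (simp_all add: minimal_tripotents_iff)
  qed
qed

end
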